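(* Let $F$ and $G$ be 1-sorted species with $F$ strictly finite, and let $F\boxtimes G$ be their inner plethysm. Then $$Z_{F\boxtimes G}=Z_F\boxtimes Z_G,$$ where the $\boxtimes$ on the right-hand side is the inner plethysm of symmetric functions.
   Context: $\mathbb{B}$ is the category of finite sets and bijections. A (1-sorted) species is a functor $F:\mathbb{B}\to\mathbb{B}$; a 2-sorted species is a functor $\mathbb{B}^2\to\mathbb{B}$. Write $[n]=\{1,\dots,n\}$ and $F[n]=F[[n]]$; the symmetric group $\mathfrak{S}_n$ acts on $F[n]$ by $\sigma\cdot t=F[\sigma](t)$. $F$ is strictly finite if there is $N$ with $F[n]=\emptyset$ for all $n>N$. Cycle index: for a partition $\lambda\vdash n$, $\mathrm{fix}\,F[\lambda]$ is the number of fixed points of $F[\sigma]$ on $F[n]$ for any $\sigma\in\mathfrak{S}_n$ of cycle type $\lambda$, and $Z_F=\sum_\lambda \mathrm{fix}\,F[\lambda]\,\frac{p_\lambda}{z_\lambda}$ (sum over all partitions), where $p_\lambda$ are the power sum symmetric functions and $z_\lambda=\prod_i i^{m_i}m_i!$ for $\lambda=(1^{m_1}2^{m_2}\cdots)$. It is a symmetric function (with rational coefficients, possibly of unbounded degree). Inner plethysm of species: for a 1-sorted species $G$, $\Phi(G)$ is the 2-sorted species $\Phi(G)(X,Y)$ for which $\Phi(G)[U,V]$ is the set of all functions from $U$ to $G[V]$ (with transport $f\mapsto G[\sigma]\circ f\circ\beta^{-1}$ along bijections $(\beta,\sigma)$). Then $F\boxtimes G=\langle F(X),\Phi(G)(X,Y)\rangle_X$,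 the scalar product in $X$; explicitly, $(F\boxtimes G)[V]=\sum_{n\ge 0}\bigl(F[n]\times\Phi(G)[[n],V]\bigr)/\mathfrak{S}_n$ (disjoint union of orbit sets), where $\mathfrak{S}_n$ acts by $\sigma\cdot(t,f)=(F[\sigma](t),f\circ\sigma^{-1})$. Inner plethysm of symmetric functions: let $\mathrm{CF}(\mathfrak{S}_n)$ be the ring of complex class functions on $\mathfrak{S}_n$ with pointwise operations and Adams operations $(\psi^k c)(\sigma)=c(\sigma^k)$. For a symmetric function $f$ of bounded degree and $\chi\in\mathrm{CF}(\mathfrak{S}_n)$, $f[\chi]$ is obtained by writing $f$ as a polynomial in the $p_k$ and substituting $\psi^k(\chi)$ for $p_k$. If $g=\sum_{\mu\vdash n}\chi_\mu\frac{p_\mu}{z_\mu}$ is homogeneous of degree $n$, identify $g$ with the class function $\chi$ taking value $\chi_\mu$ on permutations of cycle type $\mu$, and put $f\boxtimes g=\sum_{\mu\vdash n}f[\chi](\sigma_\mu)\frac{p_\mu}{z_\mu}$, where $\sigma_\mu$ has cycle type $\mu$. For general $g=\sum_{n\ge 0}g_n$ with $g_n$ homogeneous of degree $n$, put $f\boxtimes g=\sum_{n\ge0}f\boxtimes g_n$ (every degree $n$ contributes, including those with $g_n=0$, for which $\chi=0\in\mathrm{CF}(\mathfrak{S}_n)$). *)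

theory Defs
  imports Complex_Main "HOL-Library.Multiset" "HOL-Library.Poly_Mapping" "HOL-Library.FuncSet"
    "HOL-Combinatorics.Combinatorics"
begin


section \<open>Species\<close>

text \<open>
  The category \<open>\<bbbB>\<close> is rendered by its full subcategory on the finite sets of natural numbers
  (which contains every \<open>[n]\<close> and is equivalent to \<open>\<bbbB>\<close>).  The sets of structures are finite
  sets over an arbitrary type \<^typ>\<open>'s\<close>.  A bijection \<open>\<sigma> : U \<rightarrow> V\<close> is a HOL function together with its
  domain \<open>U\<close>; only its values on \<open>U\<close> may matter, and its codomain is \<open>\<sigma> ` U\<close>.  So
  \<open>transport F U \<sigma>\<close> is the map \<open>F[\<sigma>] : F[U] \<rightarrow> F[\<sigma> ` U]\<close>; its values off \<open>F[U]\<close> are irrelevant.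
\<close>

record 's species =
  structures :: "nat set \<Rightarrow> 's set"
  transport :: "nat set \<Rightarrow> (nat \<Rightarrow> nat) \<Rightarrow> 's \<Rightarrow> 's"

definition is_species :: "'s species \<Rightarrow> bool" where
  "is_species F \<longleftrightarrow>
     (\<forall>U. finite U \<longrightarrow> finite (structures F U)) \<and>
     (\<forall>U V \<sigma>. finite U \<longrightarrow> bij_betw \<sigma> U V \<longrightarrow>
        bij_betw (transport F U \<sigma>) (structures F U) (structures F V)) \<and>
     (\<forall>U \<sigma> \<sigma>'. finite U \<longrightarrow> inj_on \<sigma> U \<longrightarrow> (\<forall>u\<in>U. \<sigma> u = \<sigma>' u) \<longrightarrow>
        (\<forall>t\<in>structures F U. transport F U \<sigma> t = transport F U \<sigma>' t)) \<and>
     (\<forall>U. finite U \<longrightarrow> (\<forall>t\<in>structures F U. transport F U id t = t)) \<and>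
     (\<forall>U V W \<sigma> \<tau>. finite U \<longrightarrow> bij_betw \<sigma> U V \<longrightarrow> bij_betw \<tau> V W \<longrightarrow>
        (\<forall>t\<in>structures F U. transport F U (\<tau> \<circ> \<sigma>) t = transport F V \<tau> (transport F U \<sigma> t)))"

definition strictly_finite :: "'s species \<Rightarrow> bool" where
  "strictly_finite F \<longleftrightarrow> (\<exists>N. \<forall>n>N. structures F {1..n} = {})"

record 's species2 =
  structures2 :: "nat set \<Rightarrow> nat set \<Rightarrow> 's set"
  transport2 :: "nat set \<Rightarrow> nat set \<Rightarrow> (nat \<Rightarrow> nat) \<Rightarrow> (nat \<Rightarrow> nat) \<Rightarrow> 's \<Rightarrow> 's"

definition is_species2 :: "'s species2 \<Rightarrow> bool" where
  "is_species2 H \<longleftrightarrow>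
     (\<forall>U V. finite U \<longrightarrow> finite V \<longrightarrow> finite (structures2 H U V)) \<and>
     (\<forall>U U' V V' \<beta> \<sigma>. finite U \<longrightarrow> finite V \<longrightarrow> bij_betw \<beta> U U' \<longrightarrow> bij_betw \<sigma> V V' \<longrightarrow>
        bij_betw (transport2 H U V \<beta> \<sigma>) (structures2 H U V) (structures2 H U' V')) \<and>
     (\<forall>U V \<beta> \<beta>' \<sigma> \<sigma>'. finite U \<longrightarrow> finite V \<longrightarrow> inj_on \<beta> U \<longrightarrow> inj_on \<sigma> V \<longrightarrow>
        (\<forall>u\<in>U. \<beta> u = \<beta>' u) \<longrightarrow> (\<forall>v\<in>V. \<sigma> v = \<sigma>' v) \<longrightarrow>
        (\<forall>t\<in>structures2 H U V. transport2 H U V \<beta> \<sigma> t = transport2 H U V \<beta>' \<sigma>' t)) \<and>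
     (\<forall>U V. finite U \<longrightarrow> finite V \<longrightarrow> (\<forall>t\<in>structures2 H U V. transport2 H U V id id t = t)) \<and>
     (\<forall>U U' U'' V V' V'' \<beta> \<beta>' \<sigma> \<sigma>'. finite U \<longrightarrow> finite V \<longrightarrow>
        bij_betw \<beta> U U' \<longrightarrow> bij_betw \<beta>' U' U'' \<longrightarrow> bij_betw \<sigma> V V' \<longrightarrow> bij_betw \<sigma>' V' V'' \<longrightarrow>
        (\<forall>t\<in>structures2 H U V.
           transport2 H U V (\<beta>' \<circ> \<beta>) (\<sigma>' \<circ> \<sigma>) t = transport2 H U' V' \<beta>' \<sigma>' (transport2 H U V \<beta> \<sigma> t)))"

definition Phi :: "'t species \<Rightarrow> (nat \<Rightarrow> 't) species2" where
  "Phi G = \<lparr>structures2 = (\<lambda>U V. U \<rightarrow>\<^sub>E structures G V),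
            transport2 = (\<lambda>U V \<beta> \<sigma> f. \<lambda>i\<in>\<beta> ` U. transport G V \<sigma> (f (inv_into U \<beta> i)))\<rparr>"

abbreviation Sym :: "nat \<Rightarrow> (nat \<Rightarrow> nat) set" where
  "Sym n \<equiv> {\<sigma>. \<sigma> permutes {1..n}}"

text \<open>
  The scalar product \<open>\<langle>F(X), H(X,Y)\<rangle>\<^sub>X\<close> of species: the structures on \<open>V\<close> are the orbits of
  \<open>\<SS>\<^sub>n\<close> on \<open>F[n] \<times> H[[n],V]\<close>, for all \<open>n\<close>, made disjoint by the tag \<open>n\<close>.
\<close>

definition scalar_orbit ::
    "'s species \<Rightarrow> 't species2 \<Rightarrow> nat \<Rightarrow> nat set \<Rightarrow> 's \<times> 't \<Rightarrow> ('s \<times> 't) set" where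
  "scalar_orbit F H n V =
     (\<lambda>(t, h). {(transport F {1..n} \<sigma> t, transport2 H {1..n} V \<sigma> id h) |\<sigma>. \<sigma> \<in> Sym n})"

definition scalar_prod :: "'s species \<Rightarrow> 't species2 \<Rightarrow> (nat \<times> ('s \<times> 't) set) species" where
  "scalar_prod F H =
     \<lparr>structures = (\<lambda>V. SIGMA n:UNIV.
         scalar_orbit F H n V ` (structures F {1..n} \<times> structures2 H {1..n} V)),
      transport = (\<lambda>V \<tau> (n, A). (n, (\<lambda>(t, h). (t, transport2 H {1..n} V id \<tau> h)) ` A))\<rparr>"

definition inner_plethysm_species ::
    "'s species \<Rightarrow> 't species \<Rightarrow> (nat \<times> ('s \<times> (nat \<Rightarrow> 't)) set) species"  (infixl \<open>\<boxtimes>\<close> 70) where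
  "F \<boxtimes> G = scalar_prod F (Phi G)"


text \<open>
  The following lemmas confirm that \<^const>\<open>Phi\<close> and \<^const>\<open>inner_plethysm_species\<close> are functorial.
  Bijectivity of transports follows from the other functor laws.
\<close>

lemma is_speciesI:
  assumes fin: "\<And>U. finite U \<Longrightarrow> finite (structures F U)"
    and into: "\<And>U V \<sigma> t. \<lbrakk>finite U; bij_betw \<sigma> U V; t \<in> structures F U\<rbrakk> \<Longrightarrow>
      transport F U \<sigma> t \<in> structures F V"
    and cong: "\<And>U \<sigma> \<sigma>' t. \<lbrakk>finite U; inj_on \<sigma> U; \<forall>u\<in>U. \<sigma> u = \<sigma>' u; t \<in> structures F U\<rbrakk> \<Longrightarrow>
      transport F U \<sigma> t = transport F U \<sigma>' t"
    and ident: "\<And>U t. \<lbrakk>finite U; t \<in> structures F U\<rbrakk> \<Longrightarrow> transport F U id t = t"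
    and comp: "\<And>U V W \<sigma> \<tau> t. \<lbrakk>finite U; bij_betw \<sigma> U V; bij_betw \<tau> V W; t \<in> structures F U\<rbrakk> \<Longrightarrow>
      transport F U (\<tau> \<circ> \<sigma>) t = transport F V \<tau> (transport F U \<sigma> t)"
  shows "is_species F"
proof -
  have inverse: "transport F V (inv_into U \<sigma>) (transport F U \<sigma> t) = t"
    if "finite U" "bij_betw \<sigma> U V" "t \<in> structures F U" for U V \<sigma> t
  proof -
    have b: "bij_betw (inv_into U \<sigma>) V U" using that(2) by (rule bij_betw_inv_into)
    have "bij_betw (inv_into U \<sigma> \<circ> \<sigma>) U U" using that(2) b by (rule bij_betw_trans)
    then have "transport F U (inv_into U \<sigma> \<circ> \<sigma>) t = transport F U id t"
      using that by (intro cong) (auto simp: bij_betw_def)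
    then show ?thesis using comp[OF that(1,2) b that(3)] ident that by simp
  qed
  have bij: "bij_betw (transport F U \<sigma>) (structures F U) (structures F V)"
    if "finite U" "bij_betw \<sigma> U V" for U V \<sigma>
  proof (rule bij_betw_byWitness[where f' = "transport F V (inv_into U \<sigma>)"])
    have V: "finite V" using that bij_betw_finite by blast
    have b: "bij_betw (inv_into U \<sigma>) V U" using that(2) by (rule bij_betw_inv_into)
    show "\<forall>t\<in>structures F U. transport F V (inv_into U \<sigma>) (transport F U \<sigma> t) = t"
      using inverse that by blast
    show "\<forall>t\<in>structures F V. transport F U \<sigma> (transport F V (inv_into U \<sigma>) t) = t"
    proof
      fix t assume t: "t \<in> structures F V"
      have "bij_betw (\<sigma> \<circ> inv_into U \<sigma>) V V" using b that(2) by (rule bij_betw_trans)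
      then have "transport F V (\<sigma> \<circ> inv_into U \<sigma>) t = transport F V id t"
        using that V t by (intro cong) (auto simp: bij_betw_def f_inv_into_f)
      then show "transport F U \<sigma> (transport F V (inv_into U \<sigma>) t) = t"
        using comp[OF V b that(2) t] ident V t by simp
    qed
    show "transport F U \<sigma> ` structures F U \<subseteq> structures F V" using into that by blast
    show "transport F V (inv_into U \<sigma>) ` structures F V \<subseteq> structures F U" using into V b by blast
  qed
  show ?thesis unfolding is_species_def
    by (intro conjI allI impI ballI) (fact fin bij cong ident comp)+
qed

lemma is_species2I:
  assumes fin: "\<And>U V. \<lbrakk>finite U; finite V\<rbrakk> \<Longrightarrow> finite (structures2 H U V)"
    and into: "\<And>U U' V V' \<beta> \<sigma> t. \<lbrakk>finite U; finite V; bij_betw \<beta> U U'; bij_betw \<sigma> V V';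
      t \<in> structures2 H U V\<rbrakk> \<Longrightarrow> transport2 H U V \<beta> \<sigma> t \<in> structures2 H U' V'"
    and cong: "\<And>U V \<beta> \<beta>' \<sigma> \<sigma>' t. \<lbrakk>finite U; finite V; inj_on \<beta> U; inj_on \<sigma> V;
      \<forall>u\<in>U. \<beta> u = \<beta>' u; \<forall>v\<in>V. \<sigma> v = \<sigma>' v; t \<in> structures2 H U V\<rbrakk> \<Longrightarrow>
      transport2 H U V \<beta> \<sigma> t = transport2 H U V \<beta>' \<sigma>' t"
    and ident: "\<And>U V t. \<lbrakk>finite U; finite V; t \<in> structures2 H U V\<rbrakk> \<Longrightarrow>
      transport2 H U V id id t = t"
    and comp: "\<And>U U' U'' V V' V'' \<beta> \<beta>' \<sigma> \<sigma>' t. \<lbrakk>finite U; finite V; bij_betw \<beta> U U';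
      bij_betw \<beta>' U' U''; bij_betw \<sigma> V V'; bij_betw \<sigma>' V' V''; t \<in> structures2 H U V\<rbrakk> \<Longrightarrow>
      transport2 H U V (\<beta>' \<circ> \<beta>) (\<sigma>' \<circ> \<sigma>) t = transport2 H U' V' \<beta>' \<sigma>' (transport2 H U V \<beta> \<sigma> t)"
  shows "is_species2 H"
proof -
  have bij: "bij_betw (transport2 H U V \<beta> \<sigma>) (structures2 H U V) (structures2 H U' V')"
    if UV: "finite U" "finite V" and b: "bij_betw \<beta> U U'" "bij_betw \<sigma> V V'" for U U' V V' \<beta> \<sigma>
  proof -
    let ?\<beta> = "inv_into U \<beta>" and ?\<sigma> = "inv_into V \<sigma>"
    have UV': "finite U'" "finite V'" using that bij_betw_finite by blast+
    have b': "bij_betw ?\<beta> U' U" "bij_betw ?\<sigma> V' V" using b by (auto intro: bij_betw_inv_into)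
    show ?thesis
    proof (rule bij_betw_byWitness[where f' = "transport2 H U' V' ?\<beta> ?\<sigma>"])
      show "\<forall>t\<in>structures2 H U V. transport2 H U' V' ?\<beta> ?\<sigma> (transport2 H U V \<beta> \<sigma> t) = t"
      proof
        fix t assume t: "t \<in> structures2 H U V"
        have "bij_betw (?\<beta> \<circ> \<beta>) U U" "bij_betw (?\<sigma> \<circ> \<sigma>) V V"
          using b b' bij_betw_trans by blast+
        then have "transport2 H U V (?\<beta> \<circ> \<beta>) (?\<sigma> \<circ> \<sigma>) t = transport2 H U V id id t"
          using UV t b by (intro cong) (auto simp: bij_betw_def)
        then show "transport2 H U' V' ?\<beta> ?\<sigma> (transport2 H U V \<beta> \<sigma> t) = t"
          using comp[OF UV b(1) b'(1) b(2) b'(2) t] ident UV t by simp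
      qed
      show "\<forall>t\<in>structures2 H U' V'. transport2 H U V \<beta> \<sigma> (transport2 H U' V' ?\<beta> ?\<sigma> t) = t"
      proof
        fix t assume t: "t \<in> structures2 H U' V'"
        have "bij_betw (\<beta> \<circ> ?\<beta>) U' U'" "bij_betw (\<sigma> \<circ> ?\<sigma>) V' V'"
          using b b' bij_betw_trans by blast+
        then have "transport2 H U' V' (\<beta> \<circ> ?\<beta>) (\<sigma> \<circ> ?\<sigma>) t = transport2 H U' V' id id t"
          using UV' t b by (intro cong) (auto simp: bij_betw_def f_inv_into_f)
        then show "transport2 H U V \<beta> \<sigma> (transport2 H U' V' ?\<beta> ?\<sigma> t) = t"
          using comp[OF UV' b'(1) b(1) b'(2) b(2) t] ident UV' t by simp
      qed
      show "transport2 H U V \<beta> \<sigma> ` structures2 H U V \<subseteq> structures2 H U' V'"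
        using into UV b by blast
      show "transport2 H U' V' ?\<beta> ?\<sigma> ` structures2 H U' V' \<subseteq> structures2 H U V"
        using into UV' b' by blast
    qed
  qed
  show ?thesis unfolding is_species2_def
    apply (intro conjI allI impI ballI)
        apply (rule fin; assumption)
       apply (rule bij; assumption)
      apply (rule cong; assumption)
     apply (rule ident; assumption)
    apply (rule comp; assumption)
    done
qed

lemma
  assumes "is_species F" "finite U"
  shows species_finite: "finite (structures F U)"
    and species_into: "bij_betw \<sigma> U V \<Longrightarrow> t \<in> structures F U \<Longrightarrow> transport F U \<sigma> t \<in> structures F V"
    and species_cong: "inj_on \<sigma> U \<Longrightarrow> \<forall>u\<in>U. \<sigma> u = \<sigma>' u \<Longrightarrow> t \<in> structures F U \<Longrightarrow>
      transport F U \<sigma> t = transport F U \<sigma>' t"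
    and species_id: "t \<in> structures F U \<Longrightarrow> transport F U id t = t"
    and species_comp: "bij_betw \<sigma> U V \<Longrightarrow> bij_betw \<tau> V W \<Longrightarrow> t \<in> structures F U \<Longrightarrow>
      transport F U (\<tau> \<circ> \<sigma>) t = transport F V \<tau> (transport F U \<sigma> t)"
proof -
  note S = assms(1)[unfolded is_species_def]
  note S2 = S[THEN conjunct2] note S3 = S2[THEN conjunct2] note S4 = S3[THEN conjunct2]
  show "finite (structures F U)" using S[THEN conjunct1] assms(2) by simp
  show "transport F U \<sigma> t \<in> structures F V" if "bij_betw \<sigma> U V" "t \<in> structures F U"
    using S2[THEN conjunct1, rule_format, OF assms(2) that(1)] that(2) by (rule bij_betw_apply)
  show "transport F U \<sigma> t = transport F U \<sigma>' t"
    if "inj_on \<sigma> U" "\<forall>u\<in>U. \<sigma> u = \<sigma>' u" "t \<in> structures F U"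
    by (rule S3[THEN conjunct1, THEN spec, THEN spec, THEN spec, THEN mp, THEN mp, THEN mp,
          THEN bspec, OF assms(2) that])
  show "transport F U id t = t" if "t \<in> structures F U"
    by (rule S4[THEN conjunct1, rule_format, OF assms(2) that])
  show "transport F U (\<tau> \<circ> \<sigma>) t = transport F V \<tau> (transport F U \<sigma> t)"
    if "bij_betw \<sigma> U V" "bij_betw \<tau> V W" "t \<in> structures F U"
    by (rule S4[THEN conjunct2, rule_format, OF assms(2) that])
qed

lemma
  assumes "is_species2 H" "finite U" "finite V"
  shows species2_finite: "finite (structures2 H U V)"
    and species2_into: "bij_betw \<beta> U U' \<Longrightarrow> bij_betw \<sigma> V V' \<Longrightarrow> t \<in> structures2 H U V \<Longrightarrow>
      transport2 H U V \<beta> \<sigma> t \<in> structures2 H U' V'"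
    and species2_cong: "inj_on \<beta> U \<Longrightarrow> inj_on \<sigma> V \<Longrightarrow> \<forall>u\<in>U. \<beta> u = \<beta>' u \<Longrightarrow>
      \<forall>v\<in>V. \<sigma> v = \<sigma>' v \<Longrightarrow> t \<in> structures2 H U V \<Longrightarrow>
      transport2 H U V \<beta> \<sigma> t = transport2 H U V \<beta>' \<sigma>' t"
    and species2_id: "t \<in> structures2 H U V \<Longrightarrow> transport2 H U V id id t = t"
    and species2_comp: "bij_betw \<beta> U U' \<Longrightarrow> bij_betw \<beta>' U' U'' \<Longrightarrow> bij_betw \<sigma> V V' \<Longrightarrow>
      bij_betw \<sigma>' V' V'' \<Longrightarrow> t \<in> structures2 H U V \<Longrightarrow>
      transport2 H U V (\<beta>' \<circ> \<beta>) (\<sigma>' \<circ> \<sigma>) t = transport2 H U' V' \<beta>' \<sigma>' (transport2 H U V \<beta> \<sigma> t)"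
proof -
  note S = assms(1)[unfolded is_species2_def]
  note S2 = S[THEN conjunct2] note S3 = S2[THEN conjunct2] note S4 = S3[THEN conjunct2]
  show "finite (structures2 H U V)" using S[THEN conjunct1] assms(2,3) by simp
  show "transport2 H U V \<beta> \<sigma> t \<in> structures2 H U' V'"
    if "bij_betw \<beta> U U'" "bij_betw \<sigma> V V'" "t \<in> structures2 H U V"
    using S2[THEN conjunct1, rule_format, OF assms(2,3) that(1,2)] that(3) by (rule bij_betw_apply)
  show "transport2 H U V \<beta> \<sigma> t = transport2 H U V \<beta>' \<sigma>' t"
    if "inj_on \<beta> U" "inj_on \<sigma> V" "\<forall>u\<in>U. \<beta> u = \<beta>' u" "\<forall>v\<in>V. \<sigma> v = \<sigma>' v" "t \<in> structures2 H U V"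
    by (rule S3[THEN conjunct1, THEN spec, THEN spec, THEN spec, THEN spec, THEN spec, THEN spec,
          THEN mp, THEN mp, THEN mp, THEN mp, THEN mp, THEN mp, THEN bspec, OF assms(2,3) that])
  show "transport2 H U V id id t = t" if "t \<in> structures2 H U V"
    by (rule S4[THEN conjunct1, rule_format, OF assms(2,3) that])
  show "transport2 H U V (\<beta>' \<circ> \<beta>) (\<sigma>' \<circ> \<sigma>) t = transport2 H U' V' \<beta>' \<sigma>' (transport2 H U V \<beta> \<sigma> t)"
    if "bij_betw \<beta> U U'" "bij_betw \<beta>' U' U''" "bij_betw \<sigma> V V'" "bij_betw \<sigma>' V' V''"
      "t \<in> structures2 H U V"
    by (rule S4[THEN conjunct2, rule_format, OF assms(2,3) that])
qed

lemma is_species2_Phi: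
  assumes G: "is_species G"
  shows "is_species2 (Phi G)"
proof (rule is_species2I)
  show "finite (structures2 (Phi G) U V)" if "finite U" "finite V" for U V
    using that by (auto simp: Phi_def intro!: finite_PiE species_finite[OF G])
next
  fix U U' V V' :: "nat set" and \<beta> \<sigma> :: "nat \<Rightarrow> nat" and t
  assume a: "finite U" "finite V" "bij_betw \<beta> U U'" "bij_betw \<sigma> V V'" "t \<in> structures2 (Phi G) U V"
  then have "\<beta> ` U = U'" by (simp add: bij_betw_def)
  with a show "transport2 (Phi G) U V \<beta> \<sigma> t \<in> structures2 (Phi G) U' V'"
    by (auto simp: Phi_def PiE_iff intro!: species_into[OF G] inv_into_into)
next
  fix U V :: "nat set" and \<beta> \<beta>' \<sigma> \<sigma>' :: "nat \<Rightarrow> nat" and t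
  assume a: "finite U" "finite V" "inj_on \<beta> U" "inj_on \<sigma> V"
    "\<forall>u\<in>U. \<beta> u = \<beta>' u" "\<forall>v\<in>V. \<sigma> v = \<sigma>' v" "t \<in> structures2 (Phi G) U V"
  have im: "\<beta>' ` U = \<beta> ` U" using a(5) by auto
  have inj': "inj_on \<beta>' U" using a(3,5) by (simp add: inj_on_def)
  have "transport G V \<sigma> (t (inv_into U \<beta> i)) = transport G V \<sigma>' (t (inv_into U \<beta>' i))"
    if "i \<in> \<beta> ` U" for i
  proof -
    from that obtain u where u: "u \<in> U" "i = \<beta> u" by blast
    have "inv_into U \<beta> i = u" "inv_into U \<beta>' i = u"
      using u a(3,5) inj' by (auto simp: inv_into_f_eq)
    then show ?thesis using a u by (auto simp: Phi_def intro!: species_cong[OF G])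
  qed
  then show "transport2 (Phi G) U V \<beta> \<sigma> t = transport2 (Phi G) U V \<beta>' \<sigma>' t"
    by (auto simp: Phi_def im intro!: restrict_ext)
next
  fix U V :: "nat set" and t
  assume a: "finite U" "finite V" "t \<in> structures2 (Phi G) U V"
  show "transport2 (Phi G) U V id id t = t"
  proof
    fix i
    have "inv_into U id i = i" if "i \<in> U" using that by (intro inv_into_f_eq) auto
    then show "transport2 (Phi G) U V id id t i = t i"
      using a by (cases "i \<in> U") (auto simp: Phi_def PiE_iff extensional_def intro!: species_id[OF G])
  qed
next
  fix U U' U'' V V' V'' :: "nat set" and \<beta> \<beta>' \<sigma> \<sigma>' :: "nat \<Rightarrow> nat" and t
  assume a: "finite U" "finite V" "bij_betw \<beta> U U'" "bij_betw \<beta>' U' U''"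
    "bij_betw \<sigma> V V'" "bij_betw \<sigma>' V' V''" "t \<in> structures2 (Phi G) U V"
  have im: "\<beta> ` U = U'" "\<beta>' ` U' = U''" "(\<beta>' \<circ> \<beta>) ` U = U''"
    using a(3,4) by (auto simp: bij_betw_def)
  have "transport G V (\<sigma>' \<circ> \<sigma>) (t (inv_into U (\<beta>' \<circ> \<beta>) i)) =
      transport G V' \<sigma>' (transport G V \<sigma> (t (inv_into U \<beta> (inv_into U' \<beta>' i))))"
    and "inv_into U' \<beta>' i \<in> U'"
    if "i \<in> U''" for i
  proof -
    show j: "inv_into U' \<beta>' i \<in> U'" using that im(2) by (metis inv_into_into)
    then have u: "inv_into U \<beta> (inv_into U' \<beta>' i) \<in> U" using im(1) by (metis inv_into_into)
    have "inv_into U (\<beta>' \<circ> \<beta>) i = inv_into U \<beta> (inv_into U' \<beta>' i)"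
    proof (rule inv_into_f_eq)
      show "inj_on (\<beta>' \<circ> \<beta>) U" using a(3,4) by (auto simp: bij_betw_def intro: comp_inj_on)
      show "(\<beta>' \<circ> \<beta>) (inv_into U \<beta> (inv_into U' \<beta>' i)) = i"
        using that im j by (simp add: f_inv_into_f)
    qed (fact u)
    then show "transport G V (\<sigma>' \<circ> \<sigma>) (t (inv_into U (\<beta>' \<circ> \<beta>) i)) =
      transport G V' \<sigma>' (transport G V \<sigma> (t (inv_into U \<beta> (inv_into U' \<beta>' i))))"
      using a u by (auto simp: Phi_def intro!: species_comp[OF G])
  qed
  then show "transport2 (Phi G) U V (\<beta>' \<circ> \<beta>) (\<sigma>' \<circ> \<sigma>) t =
      transport2 (Phi G) U' V' \<beta>' \<sigma>' (transport2 (Phi G) U V \<beta> \<sigma> t)"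
    unfolding Phi_def species2.simps im by (intro restrict_ext) simp
qed

lemma is_species_scalar_prod:
  assumes F: "is_species F" and H: "is_species2 H" and sf: "strictly_finite F"
  shows "is_species (scalar_prod F H)"
proof -
  have orbit_sub: "scalar_orbit F H n V x \<subseteq> structures F {1..n} \<times> structures2 H {1..n} V"
    if "finite V" "x \<in> structures F {1..n} \<times> structures2 H {1..n} V" for n V x
    using that
    by (auto simp: scalar_orbit_def permutes_imp_bij
        intro!: species_into[OF F] species2_into[OF H])
  have tr_orbit: "(\<lambda>(t, h). (t, transport2 H {1..n} V id \<tau> h)) ` scalar_orbit F H n V (t, h) =
      scalar_orbit F H n W (t, transport2 H {1..n} V id \<tau> h)"
    if "finite V" "bij_betw \<tau> V W" "h \<in> structures2 H {1..n} V" for n t h and V W :: "nat set" and \<tau>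
  proof -
    have "transport2 H {1..n} V id \<tau> (transport2 H {1..n} V \<sigma> id h) =
        transport2 H {1..n} W \<sigma> id (transport2 H {1..n} V id \<tau> h)" if s: "\<sigma> \<in> Sym n" for \<sigma>
    proof -
      have b: "bij_betw \<sigma> {1..n} {1..n}" "bij_betw id {1..n} {1..n}" "bij_betw id V V"
          "bij_betw id W W"
        using s by (auto simp: permutes_imp_bij)
      show ?thesis
        using species2_comp[OF H _ \<open>finite V\<close> b(1,2) b(3) \<open>bij_betw \<tau> V W\<close>, of h]
          species2_comp[OF H _ \<open>finite V\<close> b(2,1) \<open>bij_betw \<tau> V W\<close> b(4), of h]
          \<open>h \<in> structures2 H {1..n} V\<close> by simp
    qed
    then show ?thesis by (auto simp: scalar_orbit_def image_iff) metis+
  qed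
  show ?thesis
  proof (rule is_speciesI)
    fix V :: "nat set" assume V: "finite V"
    obtain N where N: "\<forall>n>N. structures F {1..n} = {}" using sf by (auto simp: strictly_finite_def)
    have "structures (scalar_prod F H) V \<subseteq> (SIGMA n:{..N}.
        scalar_orbit F H n V ` (structures F {1..n} \<times> structures2 H {1..n} V))"
      using N by (fastforce simp: scalar_prod_def not_le[symmetric])
    moreover have "finite \<dots>"
      using V by (auto intro!: finite_SigmaI finite_imageI finite_cartesian_product
          species_finite[OF F] species2_finite[OF H])
    ultimately show "finite (structures (scalar_prod F H) V)" by (rule finite_subset)
  next
    fix V W :: "nat set" and \<tau> x
    assume a: "finite V" "bij_betw \<tau> V W" "x \<in> structures (scalar_prod F H) V"
    then obtain n t h where x: "x = (n, scalar_orbit F H n V (t, h))"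
      and th: "t \<in> structures F {1..n}" "h \<in> structures2 H {1..n} V"
      by (auto simp: scalar_prod_def)
    have "transport2 H {1..n} V id \<tau> h \<in> structures2 H {1..n} W"
      using a th by (intro species2_into[OF H]) auto
    with th show "transport (scalar_prod F H) V \<tau> x \<in> structures (scalar_prod F H) W"
      unfolding x using tr_orbit[OF a(1,2) th(2), of t] by (auto simp: scalar_prod_def)
  next
    fix V :: "nat set" and \<tau> \<tau>' :: "nat \<Rightarrow> nat" and x
    assume a: "finite V" "inj_on \<tau> V" "\<forall>v\<in>V. \<tau> v = \<tau>' v" "x \<in> structures (scalar_prod F H) V"
    then obtain n t h where x: "x = (n, scalar_orbit F H n V (t, h))"
      and th: "(t, h) \<in> structures F {1..n} \<times> structures2 H {1..n} V"
      by (auto simp: scalar_prod_def)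
    have "transport2 H {1..n} V id \<tau> h' = transport2 H {1..n} V id \<tau>' h'"
      if "(t', h') \<in> scalar_orbit F H n V (t, h)" for t' h'
      using a that orbit_sub[OF a(1) th] by (intro species2_cong[OF H]) auto
    then show "transport (scalar_prod F H) V \<tau> x = transport (scalar_prod F H) V \<tau>' x"
      unfolding x by (auto simp: scalar_prod_def intro!: image_cong)
  next
    fix V x
    assume a: "finite V" "x \<in> structures (scalar_prod F H) V"
    then obtain n t h where x: "x = (n, scalar_orbit F H n V (t, h))"
      and th: "(t, h) \<in> structures F {1..n} \<times> structures2 H {1..n} V"
      by (auto simp: scalar_prod_def)
    have "(\<lambda>(t, h). (t, transport2 H {1..n} V id id h)) ` scalar_orbit F H n V (t, h) =
        (\<lambda>y. y) ` scalar_orbit F H n V (t, h)"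
      using a orbit_sub[OF a(1) th]
      by (intro image_cong) (auto intro!: species2_id[OF H])
    then show "transport (scalar_prod F H) V id x = x" unfolding x by (simp add: scalar_prod_def)
  next
    fix V V' V'' :: "nat set" and \<tau> \<tau>' x
    assume a: "finite V" "bij_betw \<tau> V V'" "bij_betw \<tau>' V' V''" "x \<in> structures (scalar_prod F H) V"
    then obtain n t h where x: "x = (n, scalar_orbit F H n V (t, h))"
      and th: "(t, h) \<in> structures F {1..n} \<times> structures2 H {1..n} V"
      by (auto simp: scalar_prod_def)
    have "transport2 H {1..n} V id (\<tau>' \<circ> \<tau>) h' =
        transport2 H {1..n} V' id \<tau>' (transport2 H {1..n} V id \<tau> h')"
      if "(t', h') \<in> scalar_orbit F H n V (t, h)" for t' h'
      using a that orbit_sub[OF a(1) th]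
        species2_comp[OF H _ a(1), of "{1..n}" id "{1..n}" id "{1..n}" \<tau> V' \<tau>' V'' h'] by auto
    then show "transport (scalar_prod F H) V (\<tau>' \<circ> \<tau>) x =
        transport (scalar_prod F H) V' \<tau>' (transport (scalar_prod F H) V \<tau> x)"
      unfolding x by (auto simp: scalar_prod_def image_image split_beta intro!: image_cong)
  qed
qed

lemma is_species_inner_plethysm:
  "is_species F \<Longrightarrow> is_species G \<Longrightarrow> strictly_finite F \<Longrightarrow> is_species (F \<boxtimes> G)"
  unfolding inner_plethysm_species_def by (intro is_species_scalar_prod is_species2_Phi)

lemma structures_inner_plethysm:
  assumes "is_species G" "finite V"
  shows "structures (F \<boxtimes> G) V = (SIGMA n:UNIV.
    (\<lambda>(t, f). {(transport F {1..n} \<sigma> t, \<lambda>i\<in>{1..n}. f (inv \<sigma> i)) |\<sigma>. \<sigma> \<in> Sym n}) `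
      (structures F {1..n} \<times> ({1..n} \<rightarrow>\<^sub>E structures G V)))"
proof -
  have tr: "transport2 (Phi G) {1..n} V \<sigma> id f = (\<lambda>i\<in>{1..n}. f (inv \<sigma> i))"
    if "f \<in> {1..n} \<rightarrow>\<^sub>E structures G V" "\<sigma> \<in> Sym n" for n f \<sigma>
  proof -
    have \<sigma>: "\<sigma> permutes {1..n}" using that by simp
    have "transport G V id (f (inv_into {1..n} \<sigma> i)) = f (inv \<sigma> i)" if i: "i \<in> {1..n}" for i
    proof -
      have "inv \<sigma> i \<in> {1..n}" using \<sigma> i by (meson permutes_in_image permutes_inv)
      moreover have "inv_into {1..n} \<sigma> i = inv \<sigma> i"
        using \<sigma> calculation by (intro inv_into_f_eq) (auto simp: permutes_inj_on permutes_inverses)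
      ultimately show ?thesis
        using species_id[OF assms] \<open>f \<in> _\<close> by (simp add: PiE_iff)
    qed
    then show ?thesis using \<sigma> by (auto simp: Phi_def permutes_image intro!: restrict_ext)
  qed
  show ?thesis
    unfolding inner_plethysm_species_def scalar_prod_def scalar_orbit_def species.simps
    by (intro Sigma_cong image_cong refl) (auto simp: Phi_def tr[unfolded Phi_def, simplified])
qed


section \<open>Symmetric functions\<close>

text \<open>
  Formal power series, of possibly unbounded degree, in countably many variables
  \<open>x\<^sub>0, x\<^sub>1, x\<^sub>2, \<dots>\<close>.  A monomial is encoded as the multiset of the indices of its variables, e.g.
  \<open>{#0, 0, 3#}\<close> is \<open>x\<^sub>0\<^sup>2 x\<^sub>3\<close>; so multiplication of monomials is union and the degree is \<^const>\<open>size\<close>.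
\<close>

typedef 'a mfps = "UNIV :: (nat multiset \<Rightarrow> 'a) set"
  morphisms mcoeff Abs_mfps ..

setup_lifting type_definition_mfps

lemma mfps_eqI: "(\<And>m. mcoeff f m = mcoeff g m) \<Longrightarrow> f = g"
  by (metis ext mcoeff_inject)

lemma finite_submultisets: "finite {a. a \<subseteq># (m :: 'a multiset)}"
proof (induction m)
  case (add x m)
  have "{a. a \<subseteq># add_mset x m} \<subseteq> {a. a \<subseteq># m} \<union> add_mset x ` {a. a \<subseteq># m}"
  proof
    fix a assume "a \<in> {a. a \<subseteq># add_mset x m}"
    then have a: "a \<subseteq># add_mset x m" by simp
    show "a \<in> {a. a \<subseteq># m} \<union> add_mset x ` {a. a \<subseteq># m}"
    proof (cases "x \<in># a")
      case True
      then obtain b where "a = add_mset x b" by (meson multi_member_split)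
      with a show ?thesis by auto
    next
      case False
      then have "a \<subseteq># m" using a
        by (metis diff_single_trivial subset_eq_diff_conv add_mset_add_single)
      then show ?thesis by simp
    qed
  qed
  with add show ?case using finite_subset by blast
qed simp

lemma diff_diff_submultiset: "a \<subseteq># m \<Longrightarrow> m - (m - a) = a"
  by (simp add: multiset_eq_iff subseteq_mset_def)

instantiation mfps :: (comm_ring_1) comm_ring_1
begin

lift_definition zero_mfps :: "'a mfps" is "\<lambda>_. 0" .
lift_definition one_mfps :: "'a mfps" is "\<lambda>m. if m = {#} then 1 else 0" .
lift_definition plus_mfps :: "'a mfps \<Rightarrow> 'a mfps \<Rightarrow> 'a mfps" is "\<lambda>f g m. f m + g m" .
lift_definition minus_mfps :: "'a mfps \<Rightarrow> 'a mfps \<Rightarrow> 'a mfps" is "\<lambda>f g m. f m - g m" .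
lift_definition uminus_mfps :: "'a mfps \<Rightarrow> 'a mfps" is "\<lambda>f m. - f m" .
lift_definition times_mfps :: "'a mfps \<Rightarrow> 'a mfps \<Rightarrow> 'a mfps" is
  "\<lambda>f g m. \<Sum>a | a \<subseteq># m. f a * g (m - a)" .

instance
proof
  fix a b c :: "'a mfps"
  show "a * b * c = a * (b * c)"
  proof (rule mfps_eqI)
    fix m
    have "mcoeff (a * b * c) m =
        (\<Sum>(u, v) \<in> (SIGMA u:{u. u \<subseteq># m}. {v. v \<subseteq># u}).
           mcoeff a v * mcoeff b (u - v) * mcoeff c (m - u))"
      by (simp add: times_mfps.rep_eq sum_distrib_right sum.Sigma finite_submultisets)
    also have "\<dots> = (\<Sum>(v, w) \<in> (SIGMA v:{v. v \<subseteq># m}. {w. w \<subseteq># m - v}).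
           mcoeff a v * (mcoeff b w * mcoeff c (m - v - w)))"
      apply (rule sum.reindex_bij_witness
          [where i = "\<lambda>(v, w). (v + w, v)" and j = "\<lambda>(u, v). (v, u - v)"])
      by (auto simp: mult.assoc diff_diff_add subset_mset.add_diff_inverse
          subset_mset.le_diff_conv2 add.commute subset_mset.diff_add
          intro: subset_mset.trans mset_subset_eq_add_left)
    also have "\<dots> = mcoeff (a * (b * c)) m"
      by (simp add: times_mfps.rep_eq sum_distrib_left sum.Sigma finite_submultisets)
    finally show "mcoeff (a * b * c) m = mcoeff (a * (b * c)) m" .
  qed
  show "a * b = b * a"
  proof (rule mfps_eqI)
    fix m
    show "mcoeff (a * b) m = mcoeff (b * a) m"
      unfolding times_mfps.rep_eq
      by (rule sum.reindex_bij_witness[where i = "\<lambda>u. m - u" and j = "\<lambda>u. m - u"])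
         (auto simp: mult.commute diff_diff_submultiset)
  qed
  show "1 * a = a"
  proof (rule mfps_eqI)
    fix m
    have "mcoeff (1 * a) m = (\<Sum>u | u \<subseteq># m. if u = {#} then mcoeff a m else 0)"
      unfolding times_mfps.rep_eq one_mfps.rep_eq by (rule sum.cong) auto
    then show "mcoeff (1 * a) m = mcoeff a m" by (simp add: sum.delta' finite_submultisets)
  qed
  show "(a + b) * c = a * c + b * c"
    by (rule mfps_eqI) (simp add: times_mfps.rep_eq plus_mfps.rep_eq distrib_right sum.distrib)
  show "(0 :: 'a mfps) \<noteq> 1"
    by (metis one_mfps.rep_eq zero_mfps.rep_eq zero_neq_one)
qed (auto intro!: mfps_eqI
       simp: plus_mfps.rep_eq zero_mfps.rep_eq minus_mfps.rep_eq uminus_mfps.rep_eq)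

end

lift_definition smult_mfps :: "'a::comm_ring_1 \<Rightarrow> 'a mfps \<Rightarrow> 'a mfps" is "\<lambda>c f m. c * f m" .

definition symmetric :: "'a mfps \<Rightarrow> bool" where
  "symmetric f \<longleftrightarrow> (\<forall>\<pi> m. bij \<pi> \<longrightarrow> mcoeff f (image_mset \<pi> m) = mcoeff f m)"

lemma symmetric_mult:
  fixes f g :: "'a::comm_ring_1 mfps"
  assumes "symmetric f" "symmetric g"
  shows "symmetric (f * g)"
  unfolding symmetric_def
proof (intro allI impI)
  fix \<pi> :: "nat \<Rightarrow> nat" and m assume "bij \<pi>"
  then have inv: "image_mset (inv \<pi>) (image_mset \<pi> u) = u"
      "image_mset \<pi> (image_mset (inv \<pi>) u) = u" for u
    by (simp_all add: multiset.map_comp bij_is_inj o_def bij_is_surj surj_f_inv_f)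
  have "(\<Sum>u | u \<subseteq># m. mcoeff f u * mcoeff g (m - u)) =
      (\<Sum>u | u \<subseteq># image_mset \<pi> m. mcoeff f u * mcoeff g (image_mset \<pi> m - u))"
  proof (rule sum.reindex_bij_witness
      [where i = "image_mset (inv \<pi>)" and j = "image_mset \<pi>"], goal_cases)
    case (4 u)
    then show ?case using image_mset_subseteq_mono[of u "image_mset \<pi> m" "inv \<pi>"] inv by auto
  next
    case (5 u)
    then show ?case using assms \<open>bij \<pi>\<close>
      by (simp add: symmetric_def image_mset_Diff[symmetric])
  qed (use inv in \<open>auto intro: image_mset_subseteq_mono\<close>)
  then show "mcoeff (f * g) (image_mset \<pi> m) = mcoeff (f * g) m"
    by (simp add: times_mfps.rep_eq)
qed

lift_definition homogeneous_part :: "nat \<Rightarrow> 'a::zero mfps \<Rightarrow> 'a mfps" is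
  "\<lambda>n f m. if size m = n then f m else 0" .

text \<open>
  The formal sum of a family in which every monomial has a nonzero coefficient in only finitely
  many members.
\<close>

lift_definition formal_sum :: "('i \<Rightarrow> 'a::comm_monoid_add mfps) \<Rightarrow> 'i set \<Rightarrow> 'a mfps" is
  "\<lambda>h A m. \<Sum>i | i \<in> A \<and> h i m \<noteq> 0. h i m" .

text \<open>\<open>p\<^sub>k = \<Sum>\<^sub>i x\<^sub>i\<^sup>k\<close>, to be used for \<open>k \<ge> 1\<close> only.\<close>

lift_definition power_sum :: "nat \<Rightarrow> 'a::comm_ring_1 mfps" is
  "\<lambda>k m. if \<exists>i. m = replicate_mset k i then 1 else 0" .

definition partitions :: "nat multiset set" where
  "partitions = {\<nu>. 0 \<notin># \<nu>}"

definition partitions_of :: "nat \<Rightarrow> nat multiset set" where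
  "partitions_of n = {\<nu> \<in> partitions. sum_mset \<nu> = n}"

definition p_part :: "nat multiset \<Rightarrow> 'a::comm_ring_1 mfps" where
  "p_part \<nu> = (\<Prod>k\<in>#\<nu>. power_sum k)"

lemma symmetric_p_part: "symmetric (p_part \<nu> :: 'a::comm_ring_1 mfps)"
proof (induction \<nu>)
  case empty
  show ?case by (simp add: p_part_def symmetric_def one_mfps.rep_eq)
next
  case (add k \<nu>)
  have "symmetric (power_sum k :: 'a mfps)"
    unfolding symmetric_def power_sum.rep_eq
  proof (intro allI impI)
    fix \<pi> :: "nat \<Rightarrow> nat" and m assume "bij \<pi>"
    have "(\<exists>i. image_mset \<pi> m = replicate_mset k i) \<longleftrightarrow> (\<exists>i. m = replicate_mset k i)"
    proof
      assume "\<exists>i. image_mset \<pi> m = replicate_mset k i"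
      then obtain i where "image_mset \<pi> m = replicate_mset k i" ..
      then have "image_mset (inv \<pi>) (image_mset \<pi> m) = replicate_mset k (inv \<pi> i)" by simp
      then show "\<exists>i. m = replicate_mset k i"
        using \<open>bij \<pi>\<close> by (auto simp: multiset.map_comp bij_is_inj)
    qed auto
    then show "(if \<exists>i. image_mset \<pi> m = replicate_mset k i then 1 else 0 :: 'a) =
        (if \<exists>i. m = replicate_mset k i then 1 else 0)" by simp
  qed
  with add show ?case by (simp add: p_part_def symmetric_mult)
qed

definition z_part :: "nat multiset \<Rightarrow> nat" where
  "z_part \<nu> = (\<Prod>i\<in>set_mset \<nu>. i ^ count \<nu> i * fact (count \<nu> i))"

definition cycle_type :: "nat \<Rightarrow> (nat \<Rightarrow> nat) \<Rightarrow> nat multiset" where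
  "cycle_type n \<sigma> = image_mset card (mset_set (orbit \<sigma> ` {1..n}))"

definition perm_of_type :: "nat multiset \<Rightarrow> nat \<Rightarrow> nat" where
  "perm_of_type \<nu> = (SOME \<sigma>. \<sigma> \<in> Sym (sum_mset \<nu>) \<and> cycle_type (sum_mset \<nu>) \<sigma> = \<nu>)"


section \<open>Cycle index\<close>

definition fix_species :: "'s species \<Rightarrow> nat multiset \<Rightarrow> nat" where
  "fix_species F \<nu> = (let U = {1..sum_mset \<nu>} in
     card {t \<in> structures F U. transport F U (perm_of_type \<nu>) t = t})"

definition cycle_index :: "'s species \<Rightarrow> complex mfps" where
  "cycle_index F =
     formal_sum (\<lambda>\<nu>. smult_mfps (of_nat (fix_species F \<nu>) / of_nat (z_part \<nu>)) (p_part \<nu>)) partitions"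


lemma symmetric_cycle_index: "symmetric (cycle_index F)"
  using symmetric_p_part[where 'a = complex]
  by (simp add: symmetric_def cycle_index_def formal_sum.rep_eq smult_mfps.rep_eq)


section \<open>Inner plethysm of symmetric functions\<close>

definition class_functions :: "nat \<Rightarrow> ((nat \<Rightarrow> nat) \<Rightarrow> complex) set" where
  "class_functions n = {\<chi> \<in> extensional (Sym n).
     \<forall>\<sigma>\<in>Sym n. \<forall>\<tau>\<in>Sym n. \<chi> (\<tau> \<circ> \<sigma> \<circ> inv \<tau>) = \<chi> \<sigma>}"

definition adams :: "nat \<Rightarrow> nat \<Rightarrow> ((nat \<Rightarrow> nat) \<Rightarrow> complex) \<Rightarrow> (nat \<Rightarrow> nat) \<Rightarrow> complex" where
  "adams n k \<chi> = (\<lambda>\<sigma>\<in>Sym n. \<chi> (\<sigma> ^^ k))"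

text \<open>
  The expression of a symmetric function of bounded degree as a polynomial in the algebraically
  independent \<open>p\<^sub>k\<close>, \<open>k \<ge> 1\<close>: it maps a partition \<open>\<nu>\<close> to the coefficient of \<open>p\<^sub>\<nu> = \<Prod>\<^sub>k p\<^sub>k\<close>
  (product over the parts \<open>k\<close> of \<open>\<nu>\<close>).
\<close>

definition p_polynomial :: "complex mfps \<Rightarrow> (nat multiset \<Rightarrow>\<^sub>0 complex)" where
  "p_polynomial f = (THE c. Poly_Mapping.keys c \<subseteq> partitions \<and>
     f = (\<Sum>\<nu>\<in>Poly_Mapping.keys c. smult_mfps (Poly_Mapping.lookup c \<nu>) (p_part \<nu>)))"

text \<open>\<open>f[\<chi>]\<close>: substitute \<open>\<psi>\<^sup>k(\<chi>)\<close> for \<open>p\<^sub>k\<close> in \<open>f\<close>, computing pointwise.\<close>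

definition sf_apply ::
    "nat \<Rightarrow> complex mfps \<Rightarrow> ((nat \<Rightarrow> nat) \<Rightarrow> complex) \<Rightarrow> (nat \<Rightarrow> nat) \<Rightarrow> complex" where
  "sf_apply n f \<chi> = (\<lambda>\<sigma>\<in>Sym n. \<Sum>\<nu>\<in>Poly_Mapping.keys (p_polynomial f).
     Poly_Mapping.lookup (p_polynomial f) \<nu> * (\<Prod>k\<in>#\<nu>. adams n k \<chi> \<sigma>))"

text \<open>
  The identification of class functions \<open>\<chi>\<close> on \<open>\<SS>\<^sub>n\<close> with homogeneous symmetric functions
  \<open>\<Sum>\<^sub>\<mu> \<chi>\<^sub>\<mu> p\<^sub>\<mu> / z\<^sub>\<mu>\<close> of degree \<open>n\<close>, where \<open>\<chi>\<^sub>\<mu>\<close> is the value of \<open>\<chi>\<close> on cycle type \<open>\<mu>\<close>, and its inverse.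
\<close>

definition sf_of_class :: "nat \<Rightarrow> ((nat \<Rightarrow> nat) \<Rightarrow> complex) \<Rightarrow> complex mfps" where
  "sf_of_class n \<chi> =
     (\<Sum>\<mu>\<in>partitions_of n. smult_mfps (\<chi> (perm_of_type \<mu>) / of_nat (z_part \<mu>)) (p_part \<mu>))"

definition class_of_sf :: "nat \<Rightarrow> complex mfps \<Rightarrow> (nat \<Rightarrow> nat) \<Rightarrow> complex" where
  "class_of_sf n g = (THE \<chi>. \<chi> \<in> class_functions n \<and> sf_of_class n \<chi> = g)"

definition inner_plethysm_sf ::
    "complex mfps \<Rightarrow> complex mfps \<Rightarrow> complex mfps"  (infixl \<open>\<boxtimes>\<^sub>\<Lambda>\<close> 70) where
  "f \<boxtimes>\<^sub>\<Lambda> g =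
     formal_sum (\<lambda>n. sf_of_class n (sf_apply n f (class_of_sf n (homogeneous_part n g)))) UNIV"

end

theory Submission
  imports Defs "HOL-Library.Complex_Order"
begin

text \<open>
  Fix \<open>\<tau> \<in> \<SS>\<^sub>m\<close>.  A twisted form of Burnside's lemma counts the \<open>\<SS>\<^sub>n\<close>-orbits of pairs \<open>(t, f)\<close>
  that are fixed by \<open>\<tau>\<close>: it is the average over \<open>\<sigma> \<in> \<SS>\<^sub>n\<close> of the number of pairs on which
  \<open>\<sigma>\<close> and \<open>\<tau>\<close> act alike, that is, of the number of \<open>t\<close> fixed by \<open>\<sigma>\<close> times the number of functions
  \<open>f : [n] \<rightarrow> G[m]\<close> intertwining \<open>\<sigma>\<^sup>-\<^sup>1\<close> with \<open>G[\<tau>]\<close>.  Such an \<open>f\<close> amounts to the choice, for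
  each cycle of \<open>\<sigma>\<close> of length \<open>k\<close>, of a fixed point of \<open>G[\<tau>\<^sup>k]\<close>.  Since there are \<open>n!/z\<^sub>\<nu>\<close>
  permutations of cycle type \<open>\<nu>\<close>, summing over \<open>n\<close> gives \<open>Z\<^sub>F[\<chi>](\<tau>)\<close>, where \<open>\<chi>(\<tau>)\<close> is the
  number of fixed points of \<open>G[\<tau>]\<close>.  The symmetric function side is well defined because the
  \<open>p\<^sub>\<nu>\<close> are linearly independent: among the \<open>\<nu>\<close> in a relation take one with the most parts; a
  monomial with exponents \<open>\<nu>\<close> and pairwise distinct variables then occurs in no other \<open>p\<^sub>\<mu>\<close> of the
  relation.
\<close>

section \<open>Cycle types and intertwiners\<close>

text \<open>The carrier is an arbitrary set, so that proofs can remove one cycle at a time; what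
  remains is no longer an interval \<open>{1..n}\<close>.\<close>

definition cycle_type_on :: "'a set \<Rightarrow> ('a \<Rightarrow> 'a) \<Rightarrow> nat multiset" where
  "cycle_type_on U \<sigma> = image_mset card (mset_set (orbit \<sigma> ` U))"

lemma cycle_type_eq: "cycle_type n \<sigma> = cycle_type_on {1..n} \<sigma>"
  by (simp add: cycle_type_def cycle_type_on_def)

lemma orbit_invariant_subset:
  assumes "\<sigma> ` U = U" "u \<in> U"
  shows "orbit \<sigma> u \<subseteq> U"
proof
  fix x assume "x \<in> orbit \<sigma> u" then show "x \<in> U" using assms by induction auto
qed

text \<open>The orbits of a permutation are the classes of an equivalence relation. Since
  \<open>orbit \<sigma> u\<close> is generated from \<sigma> u rather than from u, that u lies in
  its own orbit rests on \<open>permutation \<sigma>\<close>.\<close>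

lemma orbit_eq_iff:
  assumes "permutation \<sigma>"
  shows "orbit \<sigma> x = orbit \<sigma> y \<longleftrightarrow> x \<in> orbit \<sigma> y"
proof
  assume "x \<in> orbit \<sigma> y"
  then have "y \<in> orbit \<sigma> x" using assms permutation_self_in_orbit orbit_swap by metis
  then show "orbit \<sigma> x = orbit \<sigma> y" using \<open>x \<in> orbit \<sigma> y\<close> orbit_trans by fast
qed (use assms permutation_self_in_orbit in metis)

text \<open>Identifies the length of a cycle with its period, which divides every exponent returning
  u to itself.\<close>

lemma card_orbit_eq_least_power:
  assumes "permutation \<sigma>"
  shows "card (orbit \<sigma> u) = least_power \<sigma> u"
proof -
  have "orbit \<sigma> u = set (support \<sigma> u)"
    unfolding support_set[OF assms] using orbit_altdef_permutation[OF assms] by auto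
  then show ?thesis using distinct_card[OF cycle_of_permutation[OF assms]] by simp
qed

text \<open>An injective map sends the finite orbit into itself, hence onto itself, and its image
  commutes with set difference.\<close>

lemma invariant_diff_orbit:
  assumes "permutation \<sigma>" "\<sigma> ` U = U" "u \<in> U"
  shows "\<sigma> ` (U - orbit \<sigma> u) = U - orbit \<sigma> u"
proof -
  have inj: "inj \<sigma>" using assms(1) by (simp add: permutation bij_is_inj)
  have "\<sigma> ` orbit \<sigma> u = orbit \<sigma> u"
  proof -
    have "\<sigma> ` orbit \<sigma> u \<subseteq> orbit \<sigma> u" by (auto intro: orbit.step)
    moreover have "finite (orbit \<sigma> u)"
      using assms(1) permutation_self_in_orbit finite_orbit by metis
    ultimately show ?thesis
      using inj by (meson endo_inj_surj inj_on_subset subset_UNIV)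
  qed
  then show ?thesis using image_set_diff[OF inj] assms by metis
qed

text \<open>Induction on the cycles of \<sigma> inside U. The permutation stays the same while the
  invariant set shrinks by a whole orbit, so no restricted permutation has to be formed.\<close>

lemma invariant_induct [consumes 3, case_names empty orbit]:
  assumes "finite U" "permutation \<sigma>" "\<sigma> ` U = U"
    and empty: "P {}"
    and orbit: "\<And>U u. \<lbrakk>finite U; \<sigma> ` U = U; u \<in> U; \<sigma> ` (U - orbit \<sigma> u) = U - orbit \<sigma> u;
      P (U - orbit \<sigma> u)\<rbrakk> \<Longrightarrow> P U"
  shows "P U"
  using assms(1,3)
proof (induction U rule: finite_psubset_induct)
  case (psubset U)
  show ?case
  proof (cases "U = {}")
    case True
    then show ?thesis using empty by simp
  next
    case False
    then obtain u where u: "u \<in> U" by blast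
    have "u \<in> orbit \<sigma> u" by (rule permutation_self_in_orbit[OF assms(2)])
    then have "U - orbit \<sigma> u \<subset> U" using u by blast
    then show ?thesis
      using psubset invariant_diff_orbit[OF assms(2)] u by (intro orbit[of U u]) auto
  qed
qed

lemma cycle_type_on_diff_orbit:
  assumes "permutation \<sigma>" "finite U" "\<sigma> ` U = U" "u \<in> U"
  shows "cycle_type_on U \<sigma> = add_mset (card (orbit \<sigma> u)) (cycle_type_on (U - orbit \<sigma> u) \<sigma>)"
proof -
  have self: "u \<in> orbit \<sigma> u" for u by (rule permutation_self_in_orbit[OF assms(1)])
  have "orbit \<sigma> ` U = insert (orbit \<sigma> u) (orbit \<sigma> ` (U - orbit \<sigma> u))"
    using assms(4) orbit_eq_iff[OF assms(1)] by blast
  moreover have "orbit \<sigma> u \<notin> orbit \<sigma> ` (U - orbit \<sigma> u)"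
    using orbit_eq_iff[OF assms(1)] self by blast
  ultimately show ?thesis using assms(2) by (simp add: cycle_type_on_def)
qed

lemma cycle_type_on_empty [simp]: "cycle_type_on {} \<sigma> = {#}"
  by (simp add: cycle_type_on_def)

lemma cycle_type_on_eq_empty: "finite U \<Longrightarrow> cycle_type_on U \<sigma> = {#} \<longleftrightarrow> U = {}"
  by (simp add: cycle_type_on_def mset_set_empty_iff)

lemma sum_cycle_type_on:
  assumes "finite U" "permutation \<sigma>" "\<sigma> ` U = U"
  shows "sum_mset (cycle_type_on U \<sigma>) = card U"
  using assms
proof (induction rule: invariant_induct)
  case (orbit U u)
  have "orbit \<sigma> u \<subseteq> U" using orbit by (intro orbit_invariant_subset)
  then show ?case
    using orbit assms(2) card_mono[of U "orbit \<sigma> u"]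
    by (simp add: cycle_type_on_diff_orbit card_Diff_subset finite_subset)
qed simp

lemma zero_notin_cycle_type_on:
  assumes "permutation \<sigma>"
  shows "0 \<notin># cycle_type_on U \<sigma>"
proof -
  have "finite (orbit \<sigma> u)" for u
    by (intro finite_orbit permutation_self_in_orbit assms)
  then show ?thesis
    by (cases "finite (orbit \<sigma> ` U)") (auto simp: cycle_type_on_def orbit_nonempty)
qed

section \<open>Functions intertwining two maps\<close>

definition intertwiners :: "'a set \<Rightarrow> ('a \<Rightarrow> 'a) \<Rightarrow> 'b set \<Rightarrow> ('b \<Rightarrow> 'b) \<Rightarrow> ('a \<Rightarrow> 'b) set" where
  "intertwiners U \<sigma> Y s = {f \<in> U \<rightarrow>\<^sub>E Y. \<forall>x\<in>U. f (\<sigma> x) = s (f x)}"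

lemma intertwiner_funpow:
  assumes "f \<in> intertwiners U \<sigma> Y s" "\<sigma> ` U = U" "u \<in> U"
  shows "f ((\<sigma> ^^ n) u) = (s ^^ n) (f u) \<and> (\<sigma> ^^ n) u \<in> U"
  using assms by (induction n) (auto simp: intertwiners_def)

lemma intertwiner_image_orbit:
  assumes "f \<in> intertwiners U \<sigma> Y s" "\<sigma> ` U = U" "u \<in> U"
  shows "f ` orbit \<sigma> u = orbit s (f u)"
proof -
  have "f ` orbit \<sigma> u = (\<lambda>n. f ((\<sigma> ^^ n) u)) ` {0<..}" by (auto simp: orbit_altdef)
  also have "\<dots> = (\<lambda>n. (s ^^ n) (f u)) ` {0<..}" using intertwiner_funpow[OF assms] by simp
  also have "\<dots> = orbit s (f u)" by (auto simp: orbit_altdef)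
  finally show ?thesis .
qed

text \<open>On the cycle of u an intertwiner is determined by its value at u, because every point
  there is an iterate of u.\<close>

lemma intertwiner_eqI:
  assumes "permutation \<sigma>" "\<sigma> ` U = U" "u \<in> U"
    and f: "f \<in> intertwiners U \<sigma> Y s" and g: "g \<in> intertwiners U \<sigma> Y s"
    and eq: "f u = g u" "restrict f (U - orbit \<sigma> u) = restrict g (U - orbit \<sigma> u)"
  shows "f = g"
proof
  fix x
  consider "x \<notin> U" | "x \<in> orbit \<sigma> u" | "x \<in> U - orbit \<sigma> u" by blast
  then show "f x = g x"
  proof cases
    case 1
    then show ?thesis using f g by (auto simp: intertwiners_def PiE_def extensional_def)
  next
    case 2
    then obtain n where "x = (\<sigma> ^^ n) u" by (auto simp: orbit_altdef)
    then show ?thesis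
      using intertwiner_funpow[OF f assms(2,3)] intertwiner_funpow[OF g assms(2,3)] eq by metis
  next
    case 3
    then show ?thesis using fun_cong[OF eq(2), of x] by simp
  qed
qed

text \<open>The value y at u forces the value \<open>(s ^^ i) y\<close> at
  \<open>(\<sigma> ^^ i) u\<close>. This is consistent exactly because s iterated as often as the
  cycle is long returns y to itself.\<close>

lemma intertwiner_extend:
  assumes perm: "permutation \<sigma>" and inv: "\<sigma> ` U = U" and u: "u \<in> U"
    and s: "s \<in> Y \<rightarrow> Y" and y: "y \<in> Y" "(s ^^ card (orbit \<sigma> u)) y = y"
    and f': "f' \<in> intertwiners (U - orbit \<sigma> u) \<sigma> Y s"
  obtains f where "f \<in> intertwiners U \<sigma> Y s" "f u = y" "restrict f (U - orbit \<sigma> u) = f'"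
proof -
  let ?O = "orbit \<sigma> u"
  \<comment> \<open>Any exponent reaching x is chosen here; that the choice does not matter is shown
    next, first for returns to u and then for two arbitrary exponents.\<close>
  define g where "g x = (s ^^ (SOME i. (\<sigma> ^^ i) u = x)) y" for x
  have period: "(s ^^ j) y = y" if "(\<sigma> ^^ j) u = u" for j
  proof -
    have "card ?O dvd j"
      using that by (simp add: card_orbit_eq_least_power[OF perm] least_power_dvd[OF perm])
    then obtain q where "j = card ?O * q" by blast
    moreover have "(s ^^ (card ?O * q)) y = y" for q
      by (induction q) (simp_all add: funpow_add y)
    ultimately show ?thesis by simp
  qed
  have le: "(s ^^ i) y = (s ^^ j) y" if "(\<sigma> ^^ i) u = (\<sigma> ^^ j) u" "i \<le> j" for i j
  proof -
    \<comment> \<open>Injectivity of \<sigma> cancels the common i steps.\<close>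
    have "(\<sigma> ^^ (j - i)) u = u"
      using funpow_diff[of \<sigma> i j u] that perm by (simp add: permutation bij_is_inj)
    then have "(s ^^ (j - i)) y = y" by (rule period)
    then have "(s ^^ (i + (j - i))) y = (s ^^ i) y" by (simp only: funpow_add o_apply)
    then show ?thesis using that(2) by simp
  qed
  have g: "g ((\<sigma> ^^ i) u) = (s ^^ i) y" for i
  proof -
    let ?j = "SOME j. (\<sigma> ^^ j) u = (\<sigma> ^^ i) u"
    have "(\<sigma> ^^ ?j) u = (\<sigma> ^^ i) u" by (rule someI) (rule refl)
    then show ?thesis unfolding g_def using le[of i ?j] le[of ?j i] by (metis nat_le_linear)
  qed
  define f where "f x = (if x \<in> ?O then g x else f' x)" for x
  have O: "?O \<subseteq> U" using inv u by (rule orbit_invariant_subset)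
  have pow: "(s ^^ i) y \<in> Y" for i using s y by (induction i) auto
  have inv': "\<sigma> ` (U - ?O) = U - ?O" using perm inv u by (rule invariant_diff_orbit)
  have "f \<in> intertwiners U \<sigma> Y s"
  proof -
    have "f x \<in> Y \<and> f (\<sigma> x) = s (f x)" if "x \<in> U" for x
    proof (cases "x \<in> ?O")
      case True
      then obtain i where i: "x = (\<sigma> ^^ i) u" by (auto simp: orbit_altdef)
      then show ?thesis
        using True g[of i] g[of "Suc i"] pow[of i] orbit.step[OF True] by (simp add: f_def)
    next
      case False
      then have "\<sigma> x \<in> U - ?O" using that inv' by blast
      then show ?thesis using False that f' by (auto simp: f_def intertwiners_def)
    qed
    moreover have "f x = undefined" if "x \<notin> U" for x
      using that O f' by (auto simp: f_def intertwiners_def PiE_def extensional_def)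
    ultimately show ?thesis by (auto simp: intertwiners_def)
  qed
  moreover have "f u = y"
    using g[of 0] permutation_self_in_orbit[OF perm, of u] by (simp add: f_def)
  moreover have "restrict f (U - ?O) = f'"
    using f' by (auto simp: f_def intertwiners_def PiE_def extensional_def restrict_def)
  ultimately show ?thesis by (rule that)
qed

lemma intertwiner_restrict:
  assumes "f \<in> intertwiners U \<sigma> Y s" "U' \<subseteq> U" "\<sigma> ` U' = U'"
  shows "restrict f U' \<in> intertwiners U' \<sigma> Y s"
proof -
  have "\<sigma> x \<in> U'" if "x \<in> U'" for x using that assms(3) by blast
  then show ?thesis using assms(1,2) by (auto simp: intertwiners_def PiE_iff)
qed

text \<open>Splitting off the cycle of u, of length k, makes f a pair: the value at u, which may be
  any point of Y fixed by \<open>s ^^ k\<close>, and an independent intertwiner on the other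
  cycles.\<close>

lemma card_intertwiners:
  assumes "finite U" "permutation \<sigma>" "\<sigma> ` U = U" and s: "s \<in> Y \<rightarrow> Y"
  shows "card (intertwiners U \<sigma> Y s) = (\<Prod>k\<in>#cycle_type_on U \<sigma>. card {y \<in> Y. (s ^^ k) y = y})"
  using assms(1-3)
proof (induction rule: invariant_induct)
  case empty
  have "intertwiners {} \<sigma> Y s = {\<lambda>_. undefined}" by (auto simp: intertwiners_def)
  then show ?case by simp
next
  case (orbit U u)
  let ?O = "orbit \<sigma> u"
  let ?k = "card ?O"
  have "bij_betw (\<lambda>f. (f u, restrict f (U - ?O))) (intertwiners U \<sigma> Y s)
      ({y \<in> Y. (s ^^ ?k) y = y} \<times> intertwiners (U - ?O) \<sigma> Y s)"
  proof (rule bij_betw_imageI)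
    show "inj_on (\<lambda>f. (f u, restrict f (U - ?O))) (intertwiners U \<sigma> Y s)"
      using intertwiner_eqI[OF assms(2) orbit(2,3)] by (auto intro!: inj_onI)
    show "(\<lambda>f. (f u, restrict f (U - ?O))) ` intertwiners U \<sigma> Y s =
        {y \<in> Y. (s ^^ ?k) y = y} \<times> intertwiners (U - ?O) \<sigma> Y s" (is "?L = ?R")
    proof (intro equalityI subsetI)
      fix z assume "z \<in> ?L"
      then obtain f where f: "f \<in> intertwiners U \<sigma> Y s" and z: "z = (f u, restrict f (U - ?O))"
        by blast
      have "(\<sigma> ^^ ?k) u = u"
        by (simp add: card_orbit_eq_least_power assms(2) least_power_of_permutation(1))
      then have "(s ^^ ?k) (f u) = f u"
        using intertwiner_funpow[OF f orbit(2,3), of ?k] by simp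
      moreover have "f u \<in> Y" using f orbit(3) by (auto simp: intertwiners_def)
      ultimately show "z \<in> ?R"
        using z intertwiner_restrict[OF f _ orbit(4)] by auto
    next
      fix z assume "z \<in> ?R"
      then obtain y f' where z: "z = (y, f')" "y \<in> Y" "(s ^^ ?k) y = y"
        "f' \<in> intertwiners (U - ?O) \<sigma> Y s" by blast
      then obtain f where "f \<in> intertwiners U \<sigma> Y s" "f u = y" "restrict f (U - ?O) = f'"
        using intertwiner_extend[OF assms(2) orbit(2,3) s] by blast
      then show "z \<in> ?L" using z by (intro image_eqI[of _ _ f]) auto
    qed
  qed
  then show ?case
    using orbit assms(2)
    by (simp add: bij_betw_same_card card_cartesian_product cycle_type_on_diff_orbit)
qed

text \<open>Each cycle of length k supplies k points. These will be the possible images of a point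
  on a k-cycle under a bijective intertwiner.\<close>

lemma card_points_in_orbits_of_size:
  assumes "finite V" "permutation \<rho>" "\<rho> ` V = V"
  shows "card {v \<in> V. card (orbit \<rho> v) = k} = k * count (cycle_type_on V \<rho>) k"
  using assms
proof (induction rule: invariant_induct)
  case (orbit V v)
  let ?O = "orbit \<rho> v"
  have O: "?O \<subseteq> V" using orbit by (intro orbit_invariant_subset)
  have const: "card (orbit \<rho> x) = card ?O" if "x \<in> ?O" for x
    using that orbit_eq_iff[OF assms(2)] by metis
  let ?A = "{x \<in> V - ?O. card (orbit \<rho> x) = k}"
  have A: "finite ?A" "finite ?O" using orbit O finite_subset by auto
  show ?case
  proof (cases "card ?O = k")
    case True
    then have "{x \<in> V. card (orbit \<rho> x) = k} = ?O \<union> ?A" using O const by auto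
    also have "card \<dots> = k + card ?A" using A True by (subst card_Un_disjoint) auto
    finally show ?thesis
      using orbit assms(2) True by (simp add: cycle_type_on_diff_orbit)
  next
    case False
    then have "{x \<in> V. card (orbit \<rho> x) = k} = ?A" using const by auto
    then show ?thesis
      using orbit assms(2) False by (simp add: cycle_type_on_diff_orbit)
  qed
qed simp

section \<open>The numbers \<open>z_part\<close> and bijective intertwiners\<close>

lemma z_part_empty [simp]: "z_part {#} = 1"
  by (simp add: z_part_def)

lemma z_part_pos: "0 \<notin># \<nu> \<Longrightarrow> z_part \<nu> > 0"
  unfolding z_part_def by (intro prod_pos) (metis nat_0_less_mult_iff fact_gt_zero gr0I zero_less_power)

text \<open>If k has multiplicity m, a further part k turns the factor k^m m! into k^(m+1) (m+1)!.
  The same recursion governs the count of bijective intertwiners.\<close>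

lemma z_part_add_mset: "z_part (add_mset k \<nu>) = k * Suc (count \<nu> k) * z_part \<nu>"
proof -
  let ?g = "\<lambda>\<nu> i. i ^ count \<nu> i * fact (count \<nu> i) :: nat"
  have "z_part (add_mset k \<nu>) = ?g (add_mset k \<nu>) k * prod (?g (add_mset k \<nu>)) (set_mset \<nu> - {k})"
    unfolding z_part_def set_mset_add_mset_insert
    by (simp only: prod.insert_remove finite_set_mset)
  also have "prod (?g (add_mset k \<nu>)) (set_mset \<nu> - {k}) = prod (?g \<nu>) (set_mset \<nu> - {k})"
    by (intro prod.cong) auto
  also have "?g (add_mset k \<nu>) k = k * Suc (count \<nu> k) * ?g \<nu> k" by (simp add: algebra_simps)
  finally have "z_part (add_mset k \<nu>) =
      k * Suc (count \<nu> k) * (?g \<nu> k * prod (?g \<nu>) (set_mset \<nu> - {k}))"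
    by (simp only: mult.assoc)
  also have "?g \<nu> k * prod (?g \<nu>) (set_mset \<nu> - {k}) = z_part \<nu>"
  proof (cases "k \<in># \<nu>")
    case True
    then show ?thesis unfolding z_part_def by (simp add: prod.remove)
  next
    case False
    then have "count \<nu> k = 0" by (simp add: not_in_iff)
    with False show ?thesis unfolding z_part_def by simp
  qed
  finally show ?thesis .
qed

text \<open>For U = V these are the restrictions to U of permutations conjugating \<sigma> to
  \<rho>. Two separate carriers are kept because a recursion removes a cycle from U and its image
  from V.\<close>

definition bij_intertwiners :: "'a set \<Rightarrow> ('a \<Rightarrow> 'a) \<Rightarrow> 'b set \<Rightarrow> ('b \<Rightarrow> 'b) \<Rightarrow> ('a \<Rightarrow> 'b) set" where
  "bij_intertwiners U \<sigma> V \<rho> = {f \<in> intertwiners U \<sigma> V \<rho>. bij_betw f U V}"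

lemma intertwiners_mono: "V \<subseteq> W \<Longrightarrow> intertwiners U \<sigma> V \<rho> \<subseteq> intertwiners U \<sigma> W \<rho>"
  by (auto simp: intertwiners_def PiE_iff)

lemma bij_intertwiners_restrict:
  assumes "permutation \<sigma>" "\<sigma> ` U = U" "u \<in> U" "f \<in> bij_intertwiners U \<sigma> V \<rho>"
  shows "restrict f (U - orbit \<sigma> u) \<in> bij_intertwiners (U - orbit \<sigma> u) \<sigma> (V - orbit \<rho> (f u)) \<rho>"
    and "card (orbit \<rho> (f u)) = card (orbit \<sigma> u)" and "f u \<in> V"
proof -
  let ?O = "orbit \<sigma> u"
  have f: "f \<in> intertwiners U \<sigma> V \<rho>" "inj_on f U" "f ` U = V"
    using assms(4) by (auto simp: bij_intertwiners_def bij_betw_def)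
  have O: "?O \<subseteq> U" using assms(2,3) by (rule orbit_invariant_subset)
  have img: "f ` ?O = orbit \<rho> (f u)" by (rule intertwiner_image_orbit[OF f(1) assms(2,3)])
  have "f ` (U - ?O) = V - orbit \<rho> (f u)"
    using inj_on_image_set_diff[OF f(2), of U ?O] O f(3) img by blast
  moreover have "restrict f (U - ?O) \<in> intertwiners (U - ?O) \<sigma> V \<rho>"
    using invariant_diff_orbit[OF assms(1-3)] f(1) by (intro intertwiner_restrict) auto
  ultimately show "restrict f (U - ?O) \<in> bij_intertwiners (U - ?O) \<sigma> (V - orbit \<rho> (f u)) \<rho>"
    using f(2) by (auto simp: bij_intertwiners_def intertwiners_def PiE_iff bij_betw_def inj_on_def)
  show "card (orbit \<rho> (f u)) = card ?O"
    unfolding img[symmetric] using inj_on_subset[OF f(2) O] by (rule card_image)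
  show "f u \<in> V" using f(3) assms(3) by blast
qed

lemma bij_intertwiner_extend:
  assumes \<sigma>: "permutation \<sigma>" "\<sigma> ` U = U" "u \<in> U" "finite U"
    and \<rho>: "permutation \<rho>" "\<rho> ` V = V" "v \<in> V"
    and card: "card (orbit \<rho> v) = card (orbit \<sigma> u)"
    and f': "f' \<in> bij_intertwiners (U - orbit \<sigma> u) \<sigma> (V - orbit \<rho> v) \<rho>"
  obtains f where "f \<in> bij_intertwiners U \<sigma> V \<rho>" "f u = v" "restrict f (U - orbit \<sigma> u) = f'"
proof -
  let ?O = "orbit \<sigma> u" and ?Q = "orbit \<rho> v"
  have fix_v: "(\<rho> ^^ card ?O) v = v"
    unfolding card[symmetric] card_orbit_eq_least_power[OF \<rho>(1)]
    by (rule least_power_of_permutation(1)[OF \<rho>(1)])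
  have f'': "f' \<in> intertwiners (U - ?O) \<sigma> V \<rho>"
    using f' intertwiners_mono[of "V - ?Q" V] by (auto simp: bij_intertwiners_def)
  have "\<rho> \<in> V \<rightarrow> V" using \<rho>(2) by blast
  then obtain f where f: "f \<in> intertwiners U \<sigma> V \<rho>" "f u = v" "restrict f (U - ?O) = f'"
    using intertwiner_extend[OF \<sigma>(1-3) _ \<rho>(3) fix_v f''] by blast
  have O: "?O \<subseteq> U" and Q: "?Q \<subseteq> V"
    by (rule orbit_invariant_subset[OF \<sigma>(2,3)], rule orbit_invariant_subset[OF \<rho>(2,3)])
  have fO: "f ` ?O = ?Q"
    using intertwiner_image_orbit[OF f(1) \<sigma>(2,3)] f(2) by simp
  have eq: "f x = f' x" if "x \<in> U - ?O" for x using fun_cong[OF f(3), of x] that by simp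
  have b: "bij_betw f' (U - ?O) (V - ?Q)" using f' by (simp add: bij_intertwiners_def)
  then have "bij_betw f (U - ?O) (V - ?Q)"
    using eq bij_betw_cong[of "U - ?O" f f'] by blast
  \<comment> \<open>f maps one cycle onto the other, and a surjection between finite sets of equal
    size is injective.\<close>
  moreover have "bij_betw f ?O ?Q"
    unfolding bij_betw_def using fO card \<sigma>(4) O
    by (auto intro!: eq_card_imp_inj_on finite_subset[of ?O U])
  ultimately have "bij_betw f (?O \<union> (U - ?O)) (?Q \<union> (V - ?Q))"
    by (intro bij_betw_combine) auto
  then have "bij_betw f U V" using O Q by (simp add: Un_absorb1 Un_Diff_cancel)
  then show ?thesis using f by (intro that) (simp add: bij_intertwiners_def)
qed

text \<open>A point u on a k-cycle can go to any point on a k-cycle of \<rho>. After that choice a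
  bijective intertwiner between the remaining sets, again of equal cycle type, is left. V must vary
  in the induction, since the cycle removed from it depends on the choice.\<close>

lemma card_bij_intertwiners:
  fixes \<rho> :: "'b \<Rightarrow> 'b"
  assumes "finite U" "permutation \<sigma>" "\<sigma> ` U = U"
    and "finite V" "permutation \<rho>" "\<rho> ` V = V" "cycle_type_on U \<sigma> = cycle_type_on V \<rho>"
  shows "card (bij_intertwiners U \<sigma> V \<rho>) = z_part (cycle_type_on U \<sigma>)"
  using assms(1-3,4,6,7)
proof (induction arbitrary: V rule: invariant_induct)
  case empty
  then have "V = {}" using cycle_type_on_eq_empty[of V \<rho>] by simp
  then have "bij_intertwiners {} \<sigma> V \<rho> = {\<lambda>_. undefined}"
    by (auto simp: bij_intertwiners_def intertwiners_def bij_betw_def)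
  then show ?case by simp
next
  case (orbit U u)
  note \<sigma> = assms(2) and \<rho> = assms(5)
  let ?O = "orbit \<sigma> u"
  let ?k = "card ?O"
  let ?P = "{v \<in> V. card (orbit \<rho> v) = ?k}"
  let ?B = "SIGMA v:?P. bij_intertwiners (U - ?O) \<sigma> (V - orbit \<rho> v) \<rho>"
  let ?M = "cycle_type_on (U - ?O) \<sigma>"
  have U: "cycle_type_on U \<sigma> = add_mset ?k ?M" using orbit \<sigma> by (intro cycle_type_on_diff_orbit)
  have count: "card (bij_intertwiners (U - ?O) \<sigma> (V - orbit \<rho> v) \<rho>) = z_part ?M" if "v \<in> ?P" for v
  proof (rule orbit(5))
    show "\<rho> ` (V - orbit \<rho> v) = V - orbit \<rho> v"
      using that orbit \<rho> by (intro invariant_diff_orbit) auto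
    have "cycle_type_on V \<rho> = add_mset ?k (cycle_type_on (V - orbit \<rho> v) \<rho>)"
      using cycle_type_on_diff_orbit[OF \<rho>, of V v] that orbit by simp
    then show "?M = cycle_type_on (V - orbit \<rho> v) \<rho>" using U orbit by simp
  qed (use orbit in auto)
  have "bij_betw (\<lambda>f. (f u, restrict f (U - ?O))) (bij_intertwiners U \<sigma> V \<rho>) ?B"
  proof (rule bij_betw_imageI)
    show "inj_on (\<lambda>f. (f u, restrict f (U - ?O))) (bij_intertwiners U \<sigma> V \<rho>)"
      using intertwiner_eqI[OF \<sigma> orbit(2,3)] by (auto intro!: inj_onI simp: bij_intertwiners_def)
    show "(\<lambda>f. (f u, restrict f (U - ?O))) ` bij_intertwiners U \<sigma> V \<rho> = ?B" (is "?L = _")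
    proof (intro equalityI subsetI)
      fix z assume "z \<in> ?L"
      then show "z \<in> ?B" using bij_intertwiners_restrict[OF \<sigma> orbit(2,3)] by auto
    next
      fix z assume "z \<in> ?B"
      then obtain v f' where z: "z = (v, f')" "v \<in> V" "card (orbit \<rho> v) = ?k"
        "f' \<in> bij_intertwiners (U - ?O) \<sigma> (V - orbit \<rho> v) \<rho>" by blast
      then show "z \<in> ?L"
        using bij_intertwiner_extend[OF \<sigma> orbit(2,3,1) \<rho> orbit(7) z(2-4)]
        by (metis (no_types, lifting) image_eqI z(1))
    qed
  qed
  then have "card (bij_intertwiners U \<sigma> V \<rho>) = card ?B" by (rule bij_betw_same_card)
  also have "\<dots> = card ?P * z_part ?M"
  proof -
    have "finite ?P" using orbit by simp
    \<comment> \<open>The known count is positive, whereas an infinite set would have cardinality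
      0.\<close>
    moreover have "finite (bij_intertwiners (U - ?O) \<sigma> (V - orbit \<rho> v) \<rho>)" if "v \<in> ?P" for v
      using count[OF that] z_part_pos[OF zero_notin_cycle_type_on[OF \<sigma>]]
      by (intro card_ge_0_finite) simp
    ultimately have "card ?B = (\<Sum>v\<in>?P. z_part ?M)" using count by (subst card_SigmaI) auto
    then show ?thesis by simp
  qed
  \<comment> \<open>The successor accounts for the removed cycle, which \<open>?M\<close> no longer
    contains.\<close>
  also have "card ?P = ?k * Suc (count ?M ?k)"
    using card_points_in_orbits_of_size[OF orbit(6) \<rho> orbit(7), of ?k]
    unfolding orbit(8)[symmetric] U by simp
  finally show ?case using U by (simp add: z_part_add_mset)
qed

text \<open>Taking images under f is a bijection from the cycles of \<sigma> to those of \<rho>, and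
  it preserves their sizes.\<close>

lemma cycle_type_on_bij_intertwiner:
  assumes "\<sigma> ` U = U" and f: "f \<in> bij_intertwiners U \<sigma> V \<rho>"
  shows "cycle_type_on V \<rho> = cycle_type_on U \<sigma>"
proof -
  have f': "f \<in> intertwiners U \<sigma> V \<rho>" "inj_on f U" "f ` U = V"
    using f by (auto simp: bij_intertwiners_def bij_betw_def)
  have sub: "orbit \<sigma> ` U \<subseteq> Pow U" using orbit_invariant_subset[OF assms(1)] by auto
  have "inj_on (image f) (orbit \<sigma> ` U)"
    using inj_on_image_Pow[OF f'(2)] sub by (rule inj_on_subset)
  moreover have "image f ` (orbit \<sigma> ` U) = orbit \<rho> ` V"
    using intertwiner_image_orbit[OF f'(1) assms(1)] unfolding f'(3)[symmetric] image_image
    by (intro image_cong) auto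
  ultimately have "mset_set (orbit \<rho> ` V) = image_mset (image f) (mset_set (orbit \<sigma> ` U))"
    by (metis image_mset_mset_set)
  moreover have "card (f ` X) = card X" if "X \<in># mset_set (orbit \<sigma> ` U)" for X
  proof -
    have "X \<in> orbit \<sigma> ` U" using that by (cases "finite (orbit \<sigma> ` U)") auto
    then have "X \<subseteq> U" using sub by blast
    then show ?thesis using f'(2) by (meson card_image inj_on_subset)
  qed
  ultimately show ?thesis
    unfolding cycle_type_on_def by (auto simp: multiset.map_comp intro: image_mset_cong)
qed

section \<open>Conjugation and the sizes of conjugacy classes\<close>

lemma bij_intertwiners_conjugator:
  assumes "\<beta> permutes U" "\<beta> \<circ> \<sigma> = \<rho> \<circ> \<beta>" "\<sigma> ` U = U"
  shows "restrict \<beta> U \<in> bij_intertwiners U \<sigma> U \<rho>"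
proof -
  have "\<beta> (\<sigma> x) = \<rho> (\<beta> x)" for x using fun_cong[OF assms(2), of x] by simp
  moreover have "\<sigma> x \<in> U" if "x \<in> U" for x using that assms(3) by blast
  ultimately have "restrict \<beta> U \<in> intertwiners U \<sigma> U \<rho>"
    using permutes_in_image[OF assms(1)] by (auto simp: intertwiners_def)
  then show ?thesis
    using permutes_imp_bij[OF assms(1)] by (simp add: bij_intertwiners_def)
qed

text \<open>A permutation of U is the identity off U, so restricting it to U loses nothing. For
  \<rho> = \<sigma> the set counted is the centralizer of \<sigma>.\<close>

lemma card_conjugators:
  assumes U: "finite U" and \<sigma>: "\<sigma> permutes U" and \<rho>: "\<rho> permutes U"
    and "cycle_type_on U \<sigma> = cycle_type_on U \<rho>"
  shows "card {\<beta>. \<beta> permutes U \<and> \<beta> \<circ> \<sigma> = \<rho> \<circ> \<beta>} = z_part (cycle_type_on U \<sigma>)"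
proof -
  let ?C = "{\<beta>. \<beta> permutes U \<and> \<beta> \<circ> \<sigma> = \<rho> \<circ> \<beta>}"
  have "bij_betw (\<lambda>\<beta>. restrict \<beta> U) ?C (bij_intertwiners U \<sigma> U \<rho>)"
  proof (rule bij_betw_imageI)
    show "inj_on (\<lambda>\<beta>. restrict \<beta> U) ?C"
    proof (intro inj_onI ext)
      fix \<beta> \<beta>' x
      assume "\<beta> \<in> ?C" "\<beta>' \<in> ?C" and eq: "restrict \<beta> U = restrict \<beta>' U"
      then have "\<beta> permutes U" "\<beta>' permutes U" by auto
      then show "\<beta> x = \<beta>' x"
        using fun_cong[OF eq, of x] by (cases "x \<in> U") (simp_all add: permutes_not_in)
    qed
    show "(\<lambda>\<beta>. restrict \<beta> U) ` ?C = bij_intertwiners U \<sigma> U \<rho>"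
    proof (intro equalityI subsetI)
      fix f assume "f \<in> (\<lambda>\<beta>. restrict \<beta> U) ` ?C"
      then show "f \<in> bij_intertwiners U \<sigma> U \<rho>"
        using bij_intertwiners_conjugator permutes_image[OF \<sigma>] by blast
    next
      fix f assume "f \<in> bij_intertwiners U \<sigma> U \<rho>"
      then have f: "f \<in> U \<rightarrow>\<^sub>E U" "\<And>x. x \<in> U \<Longrightarrow> f (\<sigma> x) = \<rho> (f x)" "bij_betw f U U"
        by (auto simp: bij_intertwiners_def intertwiners_def)
      define \<beta> where "\<beta> x = (if x \<in> U then f x else x)" for x
      have "bij_betw \<beta> U U" using f(3) by (simp add: \<beta>_def cong: bij_betw_cong)
      then have "\<beta> permutes U" by (rule bij_imp_permutes) (simp add: \<beta>_def)
      moreover have "\<beta> \<circ> \<sigma> = \<rho> \<circ> \<beta>"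
        using f(2) permutes_in_image[OF \<sigma>] permutes_not_in[OF \<sigma>] permutes_not_in[OF \<rho>]
        by (auto simp: \<beta>_def fun_eq_iff)
      moreover have "f = restrict \<beta> U"
        using f(1) by (auto simp: \<beta>_def fun_eq_iff PiE_def extensional_def)
      ultimately show "f \<in> (\<lambda>\<beta>. restrict \<beta> U) ` ?C" by blast
    qed
  qed
  then have "card ?C = card (bij_intertwiners U \<sigma> U \<rho>)" by (rule bij_betw_same_card)
  also have "\<dots> = z_part (cycle_type_on U \<sigma>)"
  proof (rule card_bij_intertwiners)
    show "permutation \<sigma>" "permutation \<rho>" using U \<sigma> \<rho> permutation_permutes by blast+
  qed (use assms in \<open>simp_all add: permutes_image\<close>)
  finally show ?thesis .
qed

text \<open>The number of conjugating permutations is a value of \<open>z_part\<close>, hence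
  positive.\<close>

lemma conjugate_if_same_cycle_type:
  assumes "finite U" "\<sigma> permutes U" "\<rho> permutes U" "cycle_type_on U \<sigma> = cycle_type_on U \<rho>"
  obtains \<beta> where "\<beta> permutes U" "\<beta> \<circ> \<sigma> = \<rho> \<circ> \<beta>"
proof -
  have "permutation \<sigma>" using assms permutation_permutes by blast
  then have "card {\<beta>. \<beta> permutes U \<and> \<beta> \<circ> \<sigma> = \<rho> \<circ> \<beta>} > 0"
    using card_conjugators[OF assms] z_part_pos[OF zero_notin_cycle_type_on] by metis
  then have "{\<beta>. \<beta> permutes U \<and> \<beta> \<circ> \<sigma> = \<rho> \<circ> \<beta>} \<noteq> {}" by (metis card.empty less_irrefl)
  then show ?thesis using that by blast
qed

lemma cycle_type_on_conj:
  assumes "\<beta> permutes U" "\<sigma> permutes U"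
  shows "cycle_type_on U (\<beta> \<circ> \<sigma> \<circ> inv \<beta>) = cycle_type_on U \<sigma>"
proof -
  have "\<beta> \<circ> \<sigma> = (\<beta> \<circ> \<sigma> \<circ> inv \<beta>) \<circ> \<beta>"
    using permutes_inv_o(2)[OF assms(1)] by (simp add: comp_assoc)
  then show ?thesis
    using cycle_type_on_bij_intertwiner bij_intertwiners_conjugator assms permutes_image by metis
qed

text \<open>The permutations \<beta> of U are sorted by the conjugate \<rho> of \<sigma> that they
  produce; every \<rho> of the same cycle type arises from equally many \<beta>.\<close>

lemma card_cycle_type_class:
  assumes U: "finite U" and \<sigma>: "\<sigma> permutes U"
  shows "card {\<rho>. \<rho> permutes U \<and> cycle_type_on U \<rho> = cycle_type_on U \<sigma>} *
    z_part (cycle_type_on U \<sigma>) = fact (card U)"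
proof -
  let ?C = "{\<rho>. \<rho> permutes U \<and> cycle_type_on U \<rho> = cycle_type_on U \<sigma>}"
  let ?B = "\<lambda>\<rho>. {\<beta>. \<beta> permutes U \<and> \<beta> \<circ> \<sigma> = \<rho> \<circ> \<beta>}"
  have conj: "{\<beta>. \<beta> permutes U} = (\<Union>\<rho>\<in>?C. ?B \<rho>)"
  proof (intro equalityI subsetI)
    fix \<beta> assume "\<beta> \<in> {\<beta>. \<beta> permutes U}"
    then have \<beta>: "\<beta> permutes U" by simp
    let ?\<rho> = "\<beta> \<circ> \<sigma> \<circ> inv \<beta>"
    have "?\<rho> permutes U" using \<beta> \<sigma> by (intro permutes_compose permutes_inv)
    moreover have "\<beta> \<circ> \<sigma> = ?\<rho> \<circ> \<beta>" using permutes_inv_o(2)[OF \<beta>] by (simp add: comp_assoc)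
    ultimately show "\<beta> \<in> (\<Union>\<rho>\<in>?C. ?B \<rho>)" using cycle_type_on_conj[OF \<beta> \<sigma>] \<beta> by blast
  qed blast
  have "fact (card U) = card {\<beta>. \<beta> permutes U}" by (rule card_permutations[OF refl U, symmetric])
  also have "\<dots> = card (\<Union>\<rho>\<in>?C. ?B \<rho>)" by (rule arg_cong[OF conj])
  also have "\<dots> = (\<Sum>\<rho>\<in>?C. card (?B \<rho>))"
  proof (rule card_UN_disjoint)
    show "finite ?C" by (rule finite_subset[OF _ finite_permutations[OF U]]) blast
    show "\<forall>\<rho>\<in>?C. finite (?B \<rho>)"
      by (intro ballI finite_subset[OF _ finite_permutations[OF U]]) blast
    show "\<forall>\<rho>\<in>?C. \<forall>\<rho>'\<in>?C. \<rho> \<noteq> \<rho>' \<longrightarrow> ?B \<rho> \<inter> ?B \<rho>' = {}"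
    proof (intro ballI impI, rule ccontr)
      fix \<rho> \<rho>' assume "\<rho> \<noteq> \<rho>'" "?B \<rho> \<inter> ?B \<rho>' \<noteq> {}"
      then obtain \<beta> where \<beta>: "\<beta> permutes U" "\<rho> \<circ> \<beta> = \<rho>' \<circ> \<beta>" by force
      then have "(\<rho> \<circ> \<beta>) \<circ> inv \<beta> = (\<rho>' \<circ> \<beta>) \<circ> inv \<beta>" by simp
      then have "\<rho> = \<rho>'" using permutes_inv_o(1)[OF \<beta>(1)] by (simp add: comp_assoc)
      with \<open>\<rho> \<noteq> \<rho>'\<close> show False by simp
    qed
  qed
  also have "\<dots> = (\<Sum>\<rho>\<in>?C. z_part (cycle_type_on U \<sigma>))"
    using U \<sigma> by (intro sum.cong card_conjugators) auto
  finally show ?thesis by simp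
qed

section \<open>Permutations of prescribed cycle type\<close>

lemma orbit_cycle_of_list:
  assumes "distinct cs" "cs \<noteq> []"
  shows "orbit (cycle_of_list cs) (cs ! 0) = set cs"
proof -
  \<comment> \<open>Applying the cycle i times rotates the list by i places; the first entries are
    compared.\<close>
  have pow: "(cycle_of_list cs ^^ i) (cs ! 0) = cs ! (i mod length cs)" for i
    using arg_cong[OF cyclic_rotation[OF assms(1), of i], of "\<lambda>xs. xs ! 0"] assms(2)
    by (simp add: nth_rotate)
  have "orbit (cycle_of_list cs) (cs ! 0) = {cs ! (i mod length cs) |i. True}"
    using orbit_altdef_permutation[OF permutation_of_cycle, of cs "cs ! 0"] pow by simp
  also have "\<dots> = set cs"
  proof (intro equalityI subsetI)
    fix x assume "x \<in> set cs"
    then obtain i where "i < length cs" "x = cs ! i" by (auto simp: in_set_conv_nth)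
    then show "x \<in> {cs ! (i mod length cs) |i. True}" by (auto intro!: exI[of _ i])
  qed (use assms(2) in auto)
  finally show ?thesis .
qed

text \<open>For each further part k, a k-cycle is added on the k points directly above those already
  used.\<close>

lemma exists_permutation_of_cycle_type:
  assumes "0 \<notin># \<nu>"
  shows "\<exists>\<sigma>. \<sigma> permutes {1..sum_mset \<nu>} \<and> cycle_type_on {1..sum_mset \<nu>} \<sigma> = \<nu>"
  using assms
proof (induction \<nu>)
  case empty
  show ?case by (auto intro: permutes_id)
next
  case (add k \<nu>)
  let ?n = "sum_mset \<nu>"
  obtain \<sigma> where \<sigma>: "\<sigma> permutes {1..?n}" "cycle_type_on {1..?n} \<sigma> = \<nu>" using add by auto
  define cs where "cs = [?n + 1..<?n + k + 1]"
  define c where "c = cycle_of_list cs"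
  define \<tau> where "\<tau> = c \<circ> \<sigma>"
  let ?N = "{?n + 1..?n + k}"
  have cs: "distinct cs" "cs \<noteq> []" "set cs = ?N" "cs ! 0 = ?n + 1"
    using add.prems by (auto simp: cs_def nth_append)
  have c: "c permutes ?N" using cycle_permutes[of cs] cs(3) by (simp add: c_def)
  have \<tau>: "\<tau> permutes {1..?n + k}"
    unfolding \<tau>_def
    by (intro permutes_compose permutes_subset[OF c] permutes_subset[OF \<sigma>(1)]) auto
  have on1: "\<tau> x = \<sigma> x" if "x \<in> {1..?n}" for x
  proof -
    have "\<sigma> x \<in> {1..?n}" using that permutes_in_image[OF \<sigma>(1)] by blast
    then show ?thesis using permutes_not_in[OF c, of "\<sigma> x"] by (simp add: \<tau>_def)
  qed
  have on2: "\<tau> x = c x" if "x \<in> ?N" for x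
    using that permutes_not_in[OF \<sigma>(1), of x] by (simp add: \<tau>_def)
  have n1: "?n + 1 \<in> ?N" using add.prems by auto
  \<comment> \<open>The identity intertwines c and \<tau> on the new block, which transfers the
    orbit of c to \<tau>. The same device below transfers the cycle type of \<sigma> on the old
    points.\<close>
  have "restrict id ?N \<in> intertwiners ?N c ?N \<tau>"
    using on2 permutes_in_image[OF c] by (auto simp: intertwiners_def)
  then have "orbit \<tau> (?n + 1) = restrict id ?N ` orbit c (?n + 1)"
    using intertwiner_image_orbit[OF _ permutes_image[OF c] n1] n1 by (metis id_apply restrict_apply')
  also have "orbit c (?n + 1) = ?N"
    using orbit_cycle_of_list[OF cs(1,2)] cs by (simp add: c_def)
  finally have orb: "orbit \<tau> (?n + 1) = ?N" by simp
  have "restrict id {1..?n} \<in> bij_intertwiners {1..?n} \<sigma> {1..?n} \<tau>"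
    using on1 permutes_in_image[OF \<sigma>(1)] by (auto simp: bij_intertwiners_def intertwiners_def)
  then have rest: "cycle_type_on {1..?n} \<tau> = \<nu>"
    using cycle_type_on_bij_intertwiner permutes_image[OF \<sigma>(1)] \<sigma>(2) by metis
  have "permutation \<tau>" using \<tau> permutation_permutes by blast
  then have "cycle_type_on {1..?n + k} \<tau> =
      add_mset (card ?N) (cycle_type_on ({1..?n + k} - ?N) \<tau>)"
    unfolding orb[symmetric] using n1
    by (intro cycle_type_on_diff_orbit permutes_image[OF \<tau>]) auto
  also have "{1..?n + k} - ?N = {1..?n}" by auto
  finally have "cycle_type_on {1..?n + k} \<tau> = add_mset k \<nu>" using rest by simp
  moreover have "sum_mset (add_mset k \<nu>) = ?n + k" by simp
  ultimately show ?case using \<tau> by metis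
qed

lemma perm_of_type:
  assumes "\<nu> \<in> partitions"
  shows "perm_of_type \<nu> permutes {1..sum_mset \<nu>}"
    and "cycle_type (sum_mset \<nu>) (perm_of_type \<nu>) = \<nu>"
proof -
  have "\<exists>\<sigma>. \<sigma> \<in> Sym (sum_mset \<nu>) \<and> cycle_type (sum_mset \<nu>) \<sigma> = \<nu>"
    using exists_permutation_of_cycle_type assms by (auto simp: partitions_def cycle_type_eq)
  then show "perm_of_type \<nu> permutes {1..sum_mset \<nu>}"
    and "cycle_type (sum_mset \<nu>) (perm_of_type \<nu>) = \<nu>"
    unfolding perm_of_type_def by (metis (mono_tags, lifting) mem_Collect_eq someI)+
qed

lemma cycle_type_in_partitions_of:
  assumes "\<sigma> permutes {1..n}"
  shows "cycle_type n \<sigma> \<in> partitions_of n"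
proof -
  have "permutation \<sigma>" using assms permutation_permutes by blast
  then show ?thesis
    using sum_cycle_type_on[of "{1..n}" \<sigma>] zero_notin_cycle_type_on[of \<sigma>] permutes_image[OF assms]
    by (simp add: partitions_of_def partitions_def cycle_type_eq)
qed

lemma conjugate_perm_of_type:
  assumes "\<sigma> permutes {1..n}"
  obtains \<beta> where "\<beta> permutes {1..n}" "\<beta> \<circ> \<sigma> = perm_of_type (cycle_type n \<sigma>) \<circ> \<beta>"
proof -
  let ?\<rho> = "perm_of_type (cycle_type n \<sigma>)"
  have \<nu>: "cycle_type n \<sigma> \<in> partitions" "sum_mset (cycle_type n \<sigma>) = n"
    using cycle_type_in_partitions_of[OF assms] by (auto simp: partitions_of_def)
  have "?\<rho> permutes {1..n}" using perm_of_type(1)[OF \<nu>(1)] unfolding \<nu>(2) .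
  moreover have "cycle_type_on {1..n} \<sigma> = cycle_type_on {1..n} ?\<rho>"
    using perm_of_type(2)[OF \<nu>(1)] unfolding \<nu>(2) cycle_type_eq[symmetric] by simp
  ultimately show ?thesis
    using conjugate_if_same_cycle_type[OF finite_atLeastAtMost assms] that by blast
qed

lemma card_cycle_type_eq:
  assumes "\<nu> \<in> partitions_of n"
  shows "card {\<sigma> \<in> Sym n. cycle_type n \<sigma> = \<nu>} * z_part \<nu> = fact n"
proof -
  have "\<nu> \<in> partitions" "sum_mset \<nu> = n" using assms by (auto simp: partitions_of_def)
  then show ?thesis
    using card_cycle_type_class[of "{1..n}" "perm_of_type \<nu>"] perm_of_type[of \<nu>]
    by (simp add: cycle_type_eq)
qed

text \<open>Every partition of n is the cycle type of an element of the finite group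
  \<open>Sym n\<close>.\<close>

lemma finite_partitions_of: "finite (partitions_of n)"
proof (rule finite_surj)
  show "finite (Sym n)" by (rule finite_permutations) simp
  show "partitions_of n \<subseteq> cycle_type n ` Sym n"
  proof
    fix \<nu> assume "\<nu> \<in> partitions_of n"
    then have \<nu>: "\<nu> \<in> partitions" "sum_mset \<nu> = n" by (auto simp: partitions_of_def)
    show "\<nu> \<in> cycle_type n ` Sym n"
      using perm_of_type[OF \<nu>(1)] unfolding \<nu>(2) by (intro image_eqI[of _ _ "perm_of_type \<nu>"]) auto
  qed
qed

lemma z_part_partition_pos: "\<nu> \<in> partitions \<Longrightarrow> z_part \<nu> > 0"
  by (simp add: partitions_def z_part_pos)

section \<open>Linear independence of the power sum products\<close>

lemma mcoeff_sum: "mcoeff (\<Sum>i\<in>A. f i) m = (\<Sum>i\<in>A. mcoeff (f i) m)"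
  by (induction A rule: infinite_finite_induct) (simp_all add: zero_mfps.rep_eq plus_mfps.rep_eq)

lemma p_part_empty: "p_part {#} = 1"
  by (simp add: p_part_def)

lemma p_part_add_mset: "p_part (add_mset k \<nu>) = power_sum k * p_part \<nu>"
  by (simp add: p_part_def)

lemma mcoeff_power_sum_mult:
  "mcoeff (power_sum k * g) m =
    (\<Sum>a | a \<subseteq># m \<and> (\<exists>i. a = replicate_mset k i). mcoeff g (m - a))"
  unfolding times_mfps.rep_eq power_sum.rep_eq
  by (rule sum.mono_neutral_cong_right) (auto simp: finite_submultisets)

lemma mcoeff_p_part_add_mset_nonzeroE:
  assumes "mcoeff (p_part (add_mset k \<nu>)) m \<noteq> (0 :: 'a :: comm_ring_1)"
  obtains i m' where "m = replicate_mset k i + m'" "mcoeff (p_part \<nu>) m' \<noteq> (0 :: 'a)"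
proof -
  obtain a where a: "a \<subseteq># m" "\<exists>i. a = replicate_mset k i" "mcoeff (p_part \<nu>) (m - a) \<noteq> (0 :: 'a)"
    using assms sum.not_neutral_contains_not_neutral
    unfolding p_part_add_mset mcoeff_power_sum_mult by force
  then show ?thesis using that by (metis subset_mset.add_diff_inverse)
qed

section \<open>Degrees and variables of the monomials in a power sum product\<close>

lemma mcoeff_p_part_degree:
  assumes "mcoeff (p_part \<nu>) m \<noteq> (0 :: 'a :: comm_ring_1)"
  shows "size m = sum_mset \<nu>"
  using assms
proof (induction \<nu> arbitrary: m)
  case empty
  then show ?case by (auto simp: p_part_empty one_mfps.rep_eq split: if_splits)
next
  case (add k \<nu>)
  then show ?case by (elim mcoeff_p_part_add_mset_nonzeroE) auto
qed

definition monomial_type :: "nat multiset \<Rightarrow> nat multiset" where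
  "monomial_type m = image_mset (count m) (mset_set (set_mset m))"

lemma monomial_type_replicate_plus:
  assumes "i \<notin># m" "k > 0"
  shows "monomial_type (replicate_mset k i + m) = add_mset k (monomial_type m)"
proof -
  have "count m i = 0" using assms(1) by (simp add: not_in_iff)
  moreover have "image_mset (count (replicate_mset k i + m)) (mset_set (set_mset m)) =
      image_mset (count m) (mset_set (set_mset m))"
    using assms(1) by (intro image_mset_cong) auto
  ultimately show ?thesis using assms by (simp add: monomial_type_def)
qed

lemma exists_monomial_of_type:
  assumes "\<nu> \<in> partitions"
  shows "\<exists>m. monomial_type m = \<nu>"
  using assms
proof (induction \<nu>)
  case empty
  show ?case by (intro exI[of _ "{#}"]) (simp add: monomial_type_def)
next
  case (add k \<nu>)
  then obtain m where "monomial_type m = \<nu>" "k > 0" by (auto simp: partitions_def)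
  moreover obtain i where "i \<notin># m" using ex_new_if_finite[of "set_mset m"] by auto
  ultimately show ?case using monomial_type_replicate_plus by blast
qed

text \<open>Each factor of \<open>p_part \<nu>\<close> contributes a power of one variable. The
  number of parts is reached only if these variables are pairwise distinct, and then the exponents
  are the parts.\<close>

lemma mcoeff_p_part_variables:
  assumes "mcoeff (p_part \<nu>) m \<noteq> (0 :: 'a :: comm_ring_1)"
  shows "card (set_mset m) \<le> size \<nu> \<and> (card (set_mset m) = size \<nu> \<longrightarrow> monomial_type m = \<nu>)"
  using assms
proof (induction \<nu> arbitrary: m)
  case empty
  then show ?case by (auto simp: p_part_empty one_mfps.rep_eq monomial_type_def split: if_splits)
next
  case (add k \<nu>)
  then obtain i m' where m: "m = replicate_mset k i + m'" and m': "mcoeff (p_part \<nu>) m' \<noteq> (0 :: 'a)"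
    by (elim mcoeff_p_part_add_mset_nonzeroE)
  note IH = add.IH[OF m']
  show ?case
  proof (cases "k > 0 \<and> i \<notin># m'")
    case True
    then show ?thesis using IH by (simp add: m monomial_type_replicate_plus)
  next
    case False
    \<comment> \<open>The factor brings no new variable, so the bound is strict and the equality
      case cannot occur.\<close>
    then have "set_mset m = set_mset m'" by (auto simp: m)
    then show ?thesis using IH by simp
  qed
qed

lemma mcoeff_p_part_nonneg: "mcoeff (p_part \<nu>) m \<ge> (0 :: complex)"
  by (induction \<nu> arbitrary: m)
     (auto simp: p_part_empty one_mfps.rep_eq p_part_add_mset mcoeff_power_sum_mult less_eq_complex_def
       intro: sum_nonneg)

text \<open>Matching each part with a variable of that exponent gives one positive contribution. All
  others are nonnegative, so nothing cancels; the order on the complex numbers serves only to say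
  this.\<close>

lemma mcoeff_p_part_pos:
  assumes "monomial_type m = \<nu>"
  shows "mcoeff (p_part \<nu>) m > (0 :: complex)"
  using assms
proof (induction \<nu> arbitrary: m)
  case empty
  then have "m = {#}" by (simp add: monomial_type_def mset_set_empty_iff)
  then show ?case by (simp add: p_part_empty one_mfps.rep_eq less_complex_def)
next
  case (add k \<nu>)
  then have "k \<in># monomial_type m" by simp
  then obtain i where i: "i \<in># m" "count m i = k" by (auto simp: monomial_type_def)
  let ?a = "replicate_mset k i"
  have a: "?a \<subseteq># m" using i(2) by (simp add: count_le_replicate_mset_subset_eq[symmetric])
  have "i \<notin># m - ?a" "k > 0" using i by (auto simp: in_diff_count)
  then have "monomial_type m = add_mset k (monomial_type (m - ?a))"
    using monomial_type_replicate_plus[of i "m - ?a" k] a by simp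
  then have "mcoeff (p_part \<nu>) (m - ?a) > (0 :: complex)" using add by simp
  then show ?case
    unfolding p_part_add_mset mcoeff_power_sum_mult using a mcoeff_p_part_nonneg
    by (intro sum_pos2[of _ ?a]) (auto simp: finite_submultisets)
qed

text \<open>Among the indices with nonzero coefficient, \<mu> has the most parts. The coefficient of
  a monomial of type \<mu> in the relation is then a nonzero multiple of c \<mu>.\<close>

lemma p_part_independent:
  fixes c :: "nat multiset \<Rightarrow> complex"
  assumes "finite A" "A \<subseteq> partitions"
    and zero: "(\<Sum>\<nu>\<in>A. smult_mfps (c \<nu>) (p_part \<nu>)) = 0" and "\<nu> \<in> A"
  shows "c \<nu> = 0"
proof (rule ccontr)
  assume "c \<nu> \<noteq> 0"
  define B where "B = {\<nu> \<in> A. c \<nu> \<noteq> 0}"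
  have B: "finite B" "B \<noteq> {}" using assms \<open>c \<nu> \<noteq> 0\<close> by (auto simp: B_def)
  obtain \<mu> where \<mu>: "\<mu> \<in> B" "\<And>\<kappa>. \<kappa> \<in> B \<Longrightarrow> size \<kappa> \<le> size \<mu>"
    using obtains_MAX[OF B, of size] B(1) by (metis Max_ge finite_imageI imageI)
  then obtain m where m: "monomial_type m = \<mu>"
    using exists_monomial_of_type assms(2) by (auto simp: B_def)
  have size: "card (set_mset m) = size \<mu>" by (simp add: m[symmetric] monomial_type_def)
  \<comment> \<open>With fewer parts, \<kappa> cannot produce as many variables as m has; with
    equally many, it would have to be the type of m, which is \<mu>.\<close>
  have "mcoeff (p_part \<kappa>) m = (0 :: complex)" if "\<kappa> \<in> B - {\<mu>}" for \<kappa>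
    using mcoeff_p_part_variables[of \<kappa> m] \<mu>(2)[of \<kappa>] that size m by fastforce
  then have "(\<Sum>\<kappa>\<in>A. c \<kappa> * mcoeff (p_part \<kappa>) m) = (\<Sum>\<kappa>\<in>{\<mu>}. c \<kappa> * mcoeff (p_part \<kappa>) m)"
    using \<mu>(1) by (intro sum.mono_neutral_right assms) (auto simp: B_def)
  moreover have "(\<Sum>\<kappa>\<in>A. c \<kappa> * mcoeff (p_part \<kappa>) m) = 0"
    using arg_cong[OF zero, of "\<lambda>f. mcoeff f m"]
    by (simp add: mcoeff_sum smult_mfps.rep_eq zero_mfps.rep_eq)
  ultimately show False using mcoeff_p_part_pos[OF m] \<mu>(1) by (simp add: B_def)
qed

lemma p_part_sum_eqD:
  fixes c d :: "nat multiset \<Rightarrow> complex"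
  assumes "finite A" "A \<subseteq> partitions" "\<nu> \<in> A"
    and "(\<Sum>\<nu>\<in>A. smult_mfps (c \<nu>) (p_part \<nu>)) = (\<Sum>\<nu>\<in>A. smult_mfps (d \<nu>) (p_part \<nu>))"
  shows "c \<nu> = d \<nu>"
proof -
  have "smult_mfps (c \<nu> - d \<nu>) (p_part \<nu>) = smult_mfps (c \<nu>) (p_part \<nu>) - smult_mfps (d \<nu>) (p_part \<nu>)"
    for \<nu>
    by (rule mfps_eqI) (simp add: smult_mfps.rep_eq minus_mfps.rep_eq algebra_simps)
  then have "(\<Sum>\<nu>\<in>A. smult_mfps (c \<nu> - d \<nu>) (p_part \<nu>)) = 0"
    using assms(4) by (simp add: sum_subtractf)
  then show ?thesis using p_part_independent[OF assms(1,2) _ assms(3)] by force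
qed

section \<open>Uniqueness of expansions and of class functions\<close>

lemma smult_mfps_zero [simp]: "smult_mfps 0 f = 0"
  by (rule mfps_eqI) (simp add: smult_mfps.rep_eq zero_mfps.rep_eq)

lemma sum_keys_p_part:
  assumes "finite A" "Poly_Mapping.keys c \<subseteq> A"
  shows "(\<Sum>\<nu>\<in>Poly_Mapping.keys c. smult_mfps (Poly_Mapping.lookup c \<nu>) (p_part \<nu>)) =
    (\<Sum>\<nu>\<in>A. smult_mfps (Poly_Mapping.lookup c \<nu>) (p_part \<nu>))"
  using assms by (intro sum.mono_neutral_left) (auto simp: in_keys_iff)

text \<open>Makes the definite description usable: two expansions are compared over the union of
  their supports, where linear independence applies.\<close>

lemma p_polynomial_eqI:
  assumes "Poly_Mapping.keys c \<subseteq> partitions"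
    and "f = (\<Sum>\<nu>\<in>Poly_Mapping.keys c. smult_mfps (Poly_Mapping.lookup c \<nu>) (p_part \<nu>))"
  shows "p_polynomial f = c"
  unfolding p_polynomial_def
proof (rule the_equality)
  fix d assume d: "Poly_Mapping.keys d \<subseteq> partitions \<and>
    f = (\<Sum>\<nu>\<in>Poly_Mapping.keys d. smult_mfps (Poly_Mapping.lookup d \<nu>) (p_part \<nu>))"
  let ?A = "Poly_Mapping.keys c \<union> Poly_Mapping.keys d"
  have "(\<Sum>\<nu>\<in>?A. smult_mfps (Poly_Mapping.lookup d \<nu>) (p_part \<nu>)) =
      (\<Sum>\<nu>\<in>?A. smult_mfps (Poly_Mapping.lookup c \<nu>) (p_part \<nu>))"
    using sum_keys_p_part[of ?A c] sum_keys_p_part[of ?A d] assms(2) d by simp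
  then have "Poly_Mapping.lookup d \<nu> = Poly_Mapping.lookup c \<nu>" if "\<nu> \<in> ?A" for \<nu>
    using p_part_sum_eqD[of ?A] that assms(1) d by simp
  then show "d = c" by (intro poly_mapping_eqI) (metis UnCI in_keys_iff)
qed (use assms in simp)

lemma sf_apply_sum:
  assumes "finite A" "A \<subseteq> partitions" "\<sigma> \<in> Sym n"
  shows "sf_apply n (\<Sum>\<nu>\<in>A. smult_mfps (c \<nu>) (p_part \<nu>)) \<chi> \<sigma> =
    (\<Sum>\<nu>\<in>A. c \<nu> * (\<Prod>k\<in>#\<nu>. adams n k \<chi> \<sigma>))"
proof -
  \<comment> \<open>Cutting c off outside A gives finite support. Its keys may form a proper subset
    of A, because c may vanish there.\<close>
  let ?d = "Abs_poly_mapping (\<lambda>\<nu>. if \<nu> \<in> A then c \<nu> else 0)"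
  have look: "Poly_Mapping.lookup ?d \<nu> = (if \<nu> \<in> A then c \<nu> else 0)" for \<nu>
    using assms(1) by (subst lookup_Abs_poly_mapping) (auto elim: rev_finite_subset)
  have keys: "Poly_Mapping.keys ?d \<subseteq> A" by (auto simp: in_keys_iff look split: if_splits)
  have "p_polynomial (\<Sum>\<nu>\<in>A. smult_mfps (c \<nu>) (p_part \<nu>)) = ?d"
  proof (rule p_polynomial_eqI)
    show "Poly_Mapping.keys ?d \<subseteq> partitions" using keys assms(2) by blast
    show "(\<Sum>\<nu>\<in>A. smult_mfps (c \<nu>) (p_part \<nu>)) =
        (\<Sum>\<nu>\<in>Poly_Mapping.keys ?d. smult_mfps (Poly_Mapping.lookup ?d \<nu>) (p_part \<nu>))"
      unfolding sum_keys_p_part[OF assms(1) keys] by (intro sum.cong) (auto simp: look)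
  qed
  then have "sf_apply n (\<Sum>\<nu>\<in>A. smult_mfps (c \<nu>) (p_part \<nu>)) \<chi> \<sigma> =
      (\<Sum>\<nu>\<in>Poly_Mapping.keys ?d. Poly_Mapping.lookup ?d \<nu> * (\<Prod>k\<in>#\<nu>. adams n k \<chi> \<sigma>))"
    using assms(3) by (simp add: sf_apply_def)
  also have "\<dots> = (\<Sum>\<nu>\<in>A. Poly_Mapping.lookup ?d \<nu> * (\<Prod>k\<in>#\<nu>. adams n k \<chi> \<sigma>))"
    using assms keys by (intro sum.mono_neutral_left) (auto simp: in_keys_iff)
  also have "\<dots> = (\<Sum>\<nu>\<in>A. c \<nu> * (\<Prod>k\<in>#\<nu>. adams n k \<chi> \<sigma>))"
    by (intro sum.cong) (auto simp: look)
  finally show ?thesis .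
qed

text \<open>Linear independence determines the values at the representatives
  \<open>perm_of_type \<mu>\<close>, conjugacy carries them to all of \<open>Sym n\<close>, and
  extensionality settles the rest.\<close>

lemma class_of_sf_of_class:
  assumes \<chi>: "\<chi> \<in> class_functions n"
  shows "class_of_sf n (sf_of_class n \<chi>) = \<chi>"
  unfolding class_of_sf_def
proof (rule the_equality)
  fix \<chi>' assume \<chi>': "\<chi>' \<in> class_functions n \<and> sf_of_class n \<chi>' = sf_of_class n \<chi>"
  have type: "\<chi>' (perm_of_type \<mu>) = \<chi> (perm_of_type \<mu>)" if "\<mu> \<in> partitions_of n" for \<mu>
  proof -
    have "\<chi>' (perm_of_type \<mu>) / of_nat (z_part \<mu>) = \<chi> (perm_of_type \<mu>) / of_nat (z_part \<mu>)"
      using \<chi>' that finite_partitions_of unfolding sf_of_class_def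
      by (intro p_part_sum_eqD[of "partitions_of n" \<mu>]) (auto simp: partitions_of_def)
    moreover have "z_part \<mu> > 0" using that by (simp add: partitions_of_def z_part_partition_pos)
    ultimately show ?thesis by simp
  qed
  have conj: "\<psi> \<sigma> = \<psi> (perm_of_type (cycle_type n \<sigma>))"
    if \<psi>: "\<psi> \<in> class_functions n" and \<sigma>: "\<sigma> permutes {1..n}" for \<psi> \<sigma>
  proof -
    obtain \<beta> where \<beta>: "\<beta> permutes {1..n}" "\<beta> \<circ> \<sigma> = perm_of_type (cycle_type n \<sigma>) \<circ> \<beta>"
      using \<sigma> by (rule conjugate_perm_of_type)
    then have "\<beta> \<circ> \<sigma> \<circ> inv \<beta> = perm_of_type (cycle_type n \<sigma>)"
      using permutes_inv_o(1)[OF \<beta>(1)] by (simp add: comp_assoc)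
    moreover have "\<psi> (\<beta> \<circ> \<sigma> \<circ> inv \<beta>) = \<psi> \<sigma>" using \<psi> \<sigma> \<beta>(1) by (simp add: class_functions_def)
    ultimately show ?thesis by simp
  qed
  show "\<chi>' = \<chi>"
  proof (rule extensionalityI[of _ "Sym n"])
    show "\<chi>' \<in> extensional (Sym n)" "\<chi> \<in> extensional (Sym n)"
      using \<chi> \<chi>' by (auto simp: class_functions_def)
    show "\<chi>' \<sigma> = \<chi> \<sigma>" if "\<sigma> \<in> Sym n" for \<sigma>
      using conj type cycle_type_in_partitions_of \<chi> \<chi>' that by (metis mem_Collect_eq)
  qed
qed (use \<chi> in simp)

section \<open>Coefficients of cycle indices\<close>

lemma mcoeff_p_part_eq_0:
  "\<nu> \<in> partitions - partitions_of (size m) \<Longrightarrow> mcoeff (p_part \<nu>) m = (0 :: 'a :: comm_ring_1)"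
  using mcoeff_p_part_degree by (fastforce simp: partitions_of_def)

lemma mcoeff_sum_partitions_of:
  fixes c :: "nat multiset \<Rightarrow> 'a :: comm_ring_1"
  assumes "finite A" "A \<subseteq> partitions" "\<And>\<nu>. \<nu> \<in> partitions_of (size m) - A \<Longrightarrow> c \<nu> = 0"
  shows "mcoeff (\<Sum>\<nu>\<in>A. smult_mfps (c \<nu>) (p_part \<nu>)) m =
    (\<Sum>\<nu>\<in>partitions_of (size m). c \<nu> * mcoeff (p_part \<nu>) m)"
proof -
  have "mcoeff (p_part \<nu>) m = (0 :: 'a)" if "\<nu> \<in> A - partitions_of (size m)" for \<nu>
    using that assms(2) by (intro mcoeff_p_part_eq_0) auto
  then have "(\<Sum>\<nu>\<in>A. c \<nu> * mcoeff (p_part \<nu>) m) =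
      (\<Sum>\<nu>\<in>partitions_of (size m). c \<nu> * mcoeff (p_part \<nu>) m)"
    using assms finite_partitions_of by (intro sum.mono_neutral_cong) auto
  then show ?thesis by (simp add: mcoeff_sum smult_mfps.rep_eq)
qed

lemma mcoeff_cycle_index:
  "mcoeff (cycle_index F) m = (\<Sum>\<nu>\<in>partitions_of (size m).
    of_nat (fix_species F \<nu>) / of_nat (z_part \<nu>) * mcoeff (p_part \<nu>) m)"
  unfolding cycle_index_def formal_sum.rep_eq smult_mfps.rep_eq
proof (rule sum.mono_neutral_left)
  show "{\<nu> \<in> partitions. of_nat (fix_species F \<nu>) / of_nat (z_part \<nu>) * mcoeff (p_part \<nu>) m
      \<noteq> (0 :: complex)} \<subseteq> partitions_of (size m)"
    using mcoeff_p_part_eq_0[of _ m, where 'a = complex] by auto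
  show "finite (partitions_of (size m))" by (rule finite_partitions_of)
qed (auto simp: partitions_of_def)

lemma mcoeff_sf_of_class:
  "mcoeff (sf_of_class n \<chi>) m = (if size m = n then
    \<Sum>\<mu>\<in>partitions_of n. \<chi> (perm_of_type \<mu>) / of_nat (z_part \<mu>) * mcoeff (p_part \<mu>) m else 0)"
proof -
  have "mcoeff (p_part \<mu>) m = (0 :: complex)" if "\<mu> \<in> partitions_of n" "size m \<noteq> n" for \<mu>
    using that mcoeff_p_part_degree[of \<mu> m] by (auto simp: partitions_of_def)
  then show ?thesis by (simp add: sf_of_class_def mcoeff_sum smult_mfps.rep_eq)
qed

text \<open>The summand of index n contains only monomials of degree n, so at each monomial the
  formal sum reduces to one term.\<close>

lemma mcoeff_inner_plethysm_sf:
  "mcoeff (f \<boxtimes>\<^sub>\<Lambda> g) m = mcoeff (sf_of_class (size m)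
    (sf_apply (size m) f (class_of_sf (size m) (homogeneous_part (size m) g)))) m"
    (is "_ = mcoeff (?h (size m)) m")
proof -
  have "mcoeff (f \<boxtimes>\<^sub>\<Lambda> g) m = (\<Sum>n | mcoeff (?h n) m \<noteq> 0. mcoeff (?h n) m)"
    by (simp add: inner_plethysm_sf_def formal_sum.rep_eq)
  also have "\<dots> = (\<Sum>n\<in>{size m}. mcoeff (?h n) m)"
    by (rule sum.mono_neutral_left) (auto simp: mcoeff_sf_of_class)
  finally show ?thesis by simp
qed

text \<open>Used with \<chi> the fixed point character of G, which is thereby the class function
  belonging to the degree n part of the cycle index.\<close>

lemma homogeneous_part_cycle_index:
  assumes "\<And>\<mu>. \<mu> \<in> partitions_of n \<Longrightarrow> \<chi> (perm_of_type \<mu>) = of_nat (fix_species G \<mu>)"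
  shows "homogeneous_part n (cycle_index G) = sf_of_class n \<chi>"
  by (rule mfps_eqI)
     (auto simp: homogeneous_part.rep_eq mcoeff_cycle_index mcoeff_sf_of_class assms intro!: sum.cong)

section \<open>Counting fixed orbits\<close>

lemma sum_card_fibres:
  assumes "finite S" "finite T" "f ` S \<subseteq> T"
  shows "(\<Sum>y\<in>T. card {x \<in> S. f x = y}) = card S"
  using sum.group[OF assms, of "\<lambda>_. 1 :: nat"] by simp

text \<open>Double counting of the pairs (g, x) with \<open>s x = act g x\<close>: an orbit mapped
  to itself by s contributes as many pairs as there are permutations of S, any other orbit none. For
  s the identity this is the usual Burnside lemma.\<close>

lemma twisted_burnside:
  fixes act :: "('a \<Rightarrow> 'a) \<Rightarrow> 'x \<Rightarrow> 'x" and s :: "'x \<Rightarrow> 'x"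
  assumes S: "finite S" and X: "finite X"
    and act_in: "\<And>g x. g permutes S \<Longrightarrow> x \<in> X \<Longrightarrow> act g x \<in> X"
    and act_id: "\<And>x. x \<in> X \<Longrightarrow> act id x = x"
    and act_comp: "\<And>g h x. g permutes S \<Longrightarrow> h permutes S \<Longrightarrow> x \<in> X \<Longrightarrow> act (g \<circ> h) x = act g (act h x)"
    and s_in: "\<And>x. x \<in> X \<Longrightarrow> s x \<in> X" and s_inj: "inj_on s X"
    and s_act: "\<And>g x. g permutes S \<Longrightarrow> x \<in> X \<Longrightarrow> s (act g x) = act g (s x)"
  defines "orb \<equiv> \<lambda>x. {act g x |g. g permutes S}"
  shows "card {A \<in> orb ` X. s ` A = A} * fact (card S) =
    (\<Sum>g | g permutes S. card {x \<in> X. s x = act g x})"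
proof -
  let ?P = "{g. g permutes S}"
  have P: "finite ?P" using S by (rule finite_permutations)
  have self: "x \<in> orb x" if "x \<in> X" for x
    unfolding orb_def using act_id[OF that] permutes_id[of S] by (metis (mono_tags, lifting) mem_Collect_eq)
  have sub: "orb x \<subseteq> X" if "x \<in> X" for x using that act_in by (auto simp: orb_def)
  have orb_le: "orb y \<subseteq> orb x" if x: "x \<in> X" and y: "y \<in> orb x" for x y
  proof
    fix z assume "z \<in> orb y"
    then obtain g h where "g permutes S" "h permutes S" "z = act g (act h x)"
      using y by (auto simp: orb_def)
    then have "z = act (g \<circ> h) x" "g \<circ> h permutes S"
      using act_comp[of g h x] x by (simp_all add: permutes_compose)
    then show "z \<in> orb x" unfolding orb_def by blast
  qed
  have orb_eq: "orb y = orb x" if x: "x \<in> X" and y: "y \<in> orb x" for x y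
  proof -
    obtain g where g: "g permutes S" "y = act g x" using y by (auto simp: orb_def)
    have "act (inv g) y = act (inv g \<circ> g) x" unfolding g(2)
      using act_comp[OF permutes_inv[OF g(1)] g(1) x] by simp
    then have "act (inv g) y = x" using act_id[OF x] permutes_inv_o(2)[OF g(1)] by simp
    then have "x \<in> orb y" using permutes_inv[OF g(1)] by (auto simp: orb_def)
    then show ?thesis using orb_le[OF x y] orb_le[of y x] sub[OF x] y by blast
  qed
  have s_orb: "s ` orb x = orb (s x)" if "x \<in> X" for x
    using s_act[OF _ that] by (force simp: orb_def)
  have fibre: "{y \<in> X. orb y = orb x} = orb x" if "x \<in> X" for x
    using orb_eq[OF that] self sub[OF that] by blast
  have inner: "(\<Sum>x\<in>A. card {g \<in> ?P. s x = act g x}) = (if s ` A = A then fact (card S) else 0)"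
    if A_orb: "A \<in> orb ` X" for A
  proof -
    obtain x0 where x0: "x0 \<in> X" "A = orb x0" using A_orb by blast
    have A: "A \<subseteq> X" "finite A" using sub[OF x0(1)] x0(2) X finite_subset by auto
    show ?thesis
    proof (cases "s ` A = A")
      case True
      \<comment> \<open>Writing x as \<open>act r x0\<close> and replacing g by
        \<open>g \<circ> r\<close> refers the condition to the base point x0.\<close>
      have eq: "card {g \<in> ?P. s x = act g x} = card {g \<in> ?P. act g x0 = s x}" if xA: "x \<in> A" for x
      proof -
        obtain r where r: "r permutes S" "x = act r x0" using xA x0(2) by (auto simp: orb_def)
        have 1: "act (g \<circ> r) x0 = act g x" if "g permutes S" for g
          using act_comp[OF that r(1) x0(1)] r(2) by simp
        have 2: "g \<circ> inv r \<circ> r = g" "g \<circ> r \<circ> inv r = g" for g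
          using permutes_inv_o[OF r(1)] by (simp_all add: comp_assoc)
        have "bij_betw (\<lambda>g. g \<circ> r) {g \<in> ?P. s x = act g x} {g \<in> ?P. act g x0 = s x}"
        proof (rule bij_betw_byWitness[where f' = "\<lambda>g. g \<circ> inv r"])
          show "(\<lambda>g. g \<circ> r) ` {g \<in> ?P. s x = act g x} \<subseteq> {g \<in> ?P. act g x0 = s x}"
            using 1 permutes_compose[OF r(1)] by auto
          show "(\<lambda>g. g \<circ> inv r) ` {g \<in> ?P. act g x0 = s x} \<subseteq> {g \<in> ?P. s x = act g x}"
          proof (rule image_subsetI)
            fix g assume "g \<in> {g \<in> ?P. act g x0 = s x}"
            then have g: "g permutes S" "act g x0 = s x" by auto
            have "(g \<circ> inv r) permutes S" using g permutes_inv[OF r(1)] by (intro permutes_compose)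
            then show "g \<circ> inv r \<in> {g \<in> ?P. s x = act g x}"
              using 1[of "g \<circ> inv r"] 2(1)[of g] g(2) by simp
          qed
        qed (use 2 in auto)
        then show ?thesis by (rule bij_betw_same_card)
      qed
      have "(\<Sum>x\<in>A. card {g \<in> ?P. s x = act g x}) = (\<Sum>x\<in>A. card {g \<in> ?P. act g x0 = s x})"
        using eq by (rule sum.cong[OF refl])
      \<comment> \<open>s permutes A, so the sum runs over all z in A, and the sets of g taking x0
        to z partition the group.\<close>
      also have "\<dots> = (\<Sum>z\<in>s ` A. card {g \<in> ?P. act g x0 = z})"
        using inj_on_subset[OF s_inj A(1)] by (simp add: sum.reindex)
      also have "\<dots> = card ?P"
        unfolding True using P A(2) x0(2) by (intro sum_card_fibres) (auto simp: orb_def)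
      also have "\<dots> = fact (card S)" by (rule card_permutations[OF refl S])
      finally show ?thesis using True by simp
    next
      case False
      have "{g \<in> ?P. s x = act g x} = {}" if "x \<in> A" for x
      proof (rule ccontr)
        assume "{g \<in> ?P. s x = act g x} \<noteq> {}"
        \<comment> \<open>One solution g already puts s x into the orbit of x, which would make A
          invariant under s.\<close>
        then have "s x \<in> orb x" by (auto simp: orb_def)
        moreover have "x \<in> X" "orb x = A" using that x0 A orb_eq by auto
        ultimately have "s ` A = A" using s_orb[of x] orb_eq[of x "s x"] by simp
        with False show False ..
      qed
      then have "(\<Sum>x\<in>A. card {g \<in> ?P. s x = act g x}) = 0"
        by (intro sum.neutral ballI) (simp only: card.empty)
      then show ?thesis using False by simp
    qed
  qed
  have "(\<Sum>g\<in>?P. card {x \<in> X. s x = act g x}) = (\<Sum>x\<in>X. card {g \<in> ?P. s x = act g x})"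
    using P X by (intro sum_multicount_gen) auto
  also have "\<dots> = (\<Sum>A\<in>orb ` X. \<Sum>x | x \<in> X \<and> orb x = A. card {g \<in> ?P. s x = act g x})"
    using X by (rule sum.image_gen)
  also have "\<dots> = (\<Sum>A\<in>orb ` X. if s ` A = A then fact (card S) else 0)"
  proof (rule sum.cong[OF refl])
    fix A assume A: "A \<in> orb ` X"
    then have "{x \<in> X. orb x = A} = A" using fibre by auto
    then show "(\<Sum>x | x \<in> X \<and> orb x = A. card {g \<in> ?P. s x = act g x}) =
        (if s ` A = A then fact (card S) else 0)" using inner[OF A] by simp
  qed
  also have "\<dots> = (\<Sum>A\<in>{A \<in> orb ` X. s ` A = A}. fact (card S))"
    using X by (intro sum.inter_filter[symmetric]) simp
  finally show ?thesis by simp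
qed

text \<open>Transport along \<beta> carries the structures fixed by \<sigma> bijectively to those
  fixed by \<rho>.\<close>

lemma card_fixed_conj:
  assumes F: "is_species F" and U: "finite U"
    and perm: "\<sigma> permutes U" "\<rho> permutes U" "\<beta> permutes U" and conj: "\<beta> \<circ> \<sigma> = \<rho> \<circ> \<beta>"
  shows "card {t \<in> structures F U. transport F U \<sigma> t = t} = card {t \<in> structures F U. transport F U \<rho> t = t}"
proof (rule bij_betw_same_card)
  note bij = perm[THEN permutes_imp_bij]
  have \<beta>: "inj_on (transport F U \<beta>) (structures F U)" "transport F U \<beta> ` structures F U = structures F U"
    using F[unfolded is_species_def, THEN conjunct2, THEN conjunct1, rule_format, OF U bij(3)]
    by (simp_all add: bij_betw_def)
  have eq: "transport F U \<rho> (transport F U \<beta> t) = transport F U \<beta> t \<longleftrightarrow> transport F U \<sigma> t = t"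
    if t: "t \<in> structures F U" for t
  proof -
    have "transport F U \<rho> (transport F U \<beta> t) = transport F U \<beta> (transport F U \<sigma> t)"
      using species_comp[OF F U bij(3,2) t] species_comp[OF F U bij(1,3) t] conj by simp
    then show ?thesis
      using inj_on_eq_iff[OF \<beta>(1) species_into[OF F U bij(1) t] t] by simp
  qed
  show "bij_betw (transport F U \<beta>) {t \<in> structures F U. transport F U \<sigma> t = t}
      {t \<in> structures F U. transport F U \<rho> t = t}"
  proof (rule bij_betw_imageI)
    show "inj_on (transport F U \<beta>) {t \<in> structures F U. transport F U \<sigma> t = t}"
      using \<beta>(1) by (rule inj_on_subset) blast
    show "transport F U \<beta> ` {t \<in> structures F U. transport F U \<sigma> t = t} =
        {t \<in> structures F U. transport F U \<rho> t = t}"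
      using eq \<beta>(2) by (auto 0 4 simp: image_iff)
  qed
qed

lemma fix_species_eq:
  assumes "sum_mset \<mu> = n"
  shows "fix_species F \<mu> = card {t \<in> structures F {1..n}. transport F {1..n} (perm_of_type \<mu>) t = t}"
  using assms by (simp add: fix_species_def Let_def)

text \<open>Replaces the chosen representative in \<open>fix_species\<close> by an arbitrary
  permutation of the same cycle type.\<close>

lemma card_fixed_eq_fix_species:
  assumes "is_species F" "\<sigma> permutes {1..n}"
  shows "card {t \<in> structures F {1..n}. transport F {1..n} \<sigma> t = t} = fix_species F (cycle_type n \<sigma>)"
proof -
  have \<nu>: "cycle_type n \<sigma> \<in> partitions" "sum_mset (cycle_type n \<sigma>) = n"
    using cycle_type_in_partitions_of[OF assms(2)] by (auto simp: partitions_of_def)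
  have "perm_of_type (cycle_type n \<sigma>) permutes {1..n}" using perm_of_type(1)[OF \<nu>(1)] unfolding \<nu>(2) .
  moreover obtain \<beta> where "\<beta> permutes {1..n}" "\<beta> \<circ> \<sigma> = perm_of_type (cycle_type n \<sigma>) \<circ> \<beta>"
    using assms(2) by (rule conjugate_perm_of_type)
  ultimately show ?thesis
    unfolding fix_species_eq[OF \<nu>(2)] using assms by (intro card_fixed_conj) auto
qed

section \<open>The two actions on \<open>Phi G\<close>\<close>

lemma transport_funpow:
  assumes "is_species G" "finite V" "\<tau> permutes V" "y \<in> structures G V"
  shows "(transport G V \<tau> ^^ k) y = transport G V (\<tau> ^^ k) y"
proof (induction k)
  case 0
  then show ?case using species_id[OF assms(1,2,4)] by (simp add: id_def)
next
  case (Suc k)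
  have "transport G V (\<tau> \<circ> \<tau> ^^ k) y = transport G V \<tau> (transport G V (\<tau> ^^ k) y)"
    using assms permutes_imp_bij permutes_funpow by (intro species_comp) blast+
  then show ?case using Suc by (simp add: o_def)
qed

lemma transport2_Phi_left:
  assumes "is_species G" "finite V" "\<sigma> permutes U" "h \<in> U \<rightarrow>\<^sub>E structures G V"
  shows "transport2 (Phi G) U V \<sigma> id h = (\<lambda>i\<in>U. h (inv \<sigma> i))"
proof -
  have "transport G V id (h (inv_into U \<sigma> i)) = h (inv \<sigma> i)" if i: "i \<in> U" for i
  proof -
    have "inv \<sigma> i \<in> U" using assms(3) i by (meson permutes_in_image permutes_inv)
    moreover have "inv_into U \<sigma> i = inv \<sigma> i"
      using assms(3) calculation by (intro inv_into_f_eq) (auto simp: permutes_inj_on permutes_inverses)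
    ultimately show ?thesis using species_id[OF assms(1,2)] assms(4) by (simp add: PiE_iff)
  qed
  then show ?thesis using assms(3) by (auto simp: Phi_def permutes_image intro!: restrict_ext)
qed

lemma transport2_Phi_right: "transport2 (Phi G) U V id \<tau> h = (\<lambda>i\<in>U. transport G V \<tau> (h i))"
proof -
  have "inv_into U id i = i" if "i \<in> U" for i using that by (intro inv_into_f_eq) auto
  then show ?thesis by (auto simp: Phi_def intro!: restrict_ext)
qed

text \<open>\<sigma> acts by precomposition with its inverse and \<tau> by postcomposition with its
  transport; equality of the two results is the intertwining condition.\<close>

lemma fixed_Phi_eq_intertwiners:
  assumes "is_species G" "finite V" "\<sigma> permutes U"
  shows "{h \<in> structures2 (Phi G) U V. transport2 (Phi G) U V id \<tau> h = transport2 (Phi G) U V \<sigma> id h} =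
    intertwiners U (inv \<sigma>) (structures G V) (transport G V \<tau>)"
proof -
  have "transport2 (Phi G) U V id \<tau> h = transport2 (Phi G) U V \<sigma> id h \<longleftrightarrow>
      (\<forall>i\<in>U. h (inv \<sigma> i) = transport G V \<tau> (h i))" if "h \<in> U \<rightarrow>\<^sub>E structures G V" for h
    unfolding transport2_Phi_left[OF assms that] transport2_Phi_right
    by (auto simp: restrict_def fun_eq_iff split: if_splits)
  then show ?thesis by (auto simp: intertwiners_def Phi_def[THEN arg_cong, of structures2])
qed

lemma card_fixed_Phi:
  assumes G: "is_species G" and V: "finite V" and \<sigma>: "\<sigma> permutes {1..n}" and \<tau>: "\<tau> permutes V"
  shows "card {h \<in> structures2 (Phi G) {1..n} V.
      transport2 (Phi G) {1..n} V id \<tau> h = transport2 (Phi G) {1..n} V \<sigma> id h} =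
    (\<Prod>k\<in>#cycle_type n \<sigma>. card {y \<in> structures G V. transport G V (\<tau> ^^ k) y = y})"
proof -
  have perm: "permutation \<sigma>" "permutation (inv \<sigma>)"
    using \<sigma> permutes_inv permutation_permutes by blast+
  have pow: "{y \<in> structures G V. (transport G V \<tau> ^^ k) y = y} =
      {y \<in> structures G V. transport G V (\<tau> ^^ k) y = y}" for k
    using transport_funpow[OF G V \<tau>] by auto
  have "transport G V \<tau> \<in> structures G V \<rightarrow> structures G V"
    using species_into[OF G V permutes_imp_bij[OF \<tau>]] by blast
  then have "card (intertwiners {1..n} (inv \<sigma>) (structures G V) (transport G V \<tau>)) =
      (\<Prod>k\<in>#cycle_type_on {1..n} (inv \<sigma>). card {y \<in> structures G V. (transport G V \<tau> ^^ k) y = y})"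
    using perm(2) permutes_image[OF permutes_inv[OF \<sigma>]] by (intro card_intertwiners) auto
  \<comment> \<open>A permutation and its inverse have the same orbits.\<close>
  also have "cycle_type_on {1..n} (inv \<sigma>) = cycle_type n \<sigma>"
    unfolding cycle_type_eq cycle_type_on_def by (simp add: orbit_inv_eq[OF perm(1)])
  finally show ?thesis unfolding fixed_Phi_eq_intertwiners[OF G V \<sigma>] pow .
qed

text \<open>Twisted Burnside for pairs (t, h): by functoriality in two variables, \<tau> on V
  commutes with the permutations of \<open>{1..n}\<close>, and it is injective because its inverse
  is also transported.\<close>

lemma card_fixed_scalar_orbits:
  assumes F: "is_species F" and H: "is_species2 H" and V: "finite V" and \<tau>: "\<tau> permutes V"
  shows "card {A \<in> scalar_orbit F H n V ` (structures F {1..n} \<times> structures2 H {1..n} V).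
      (\<lambda>(t, h). (t, transport2 H {1..n} V id \<tau> h)) ` A = A} * fact n =
    (\<Sum>\<sigma>\<in>Sym n. card {t \<in> structures F {1..n}. transport F {1..n} \<sigma> t = t} *
      card {h \<in> structures2 H {1..n} V. transport2 H {1..n} V id \<tau> h = transport2 H {1..n} V \<sigma> id h})"
proof -
  let ?U = "{1..n}" and ?X = "structures F {1..n} \<times> structures2 H {1..n} V"
  let ?s = "\<lambda>(t, h). (t, transport2 H {1..n} V id \<tau> h)"
  define act where "act \<sigma> = (\<lambda>(t, h). (transport F ?U \<sigma> t, transport2 H ?U V \<sigma> id h))" for \<sigma>
  note bij = permutes_imp_bij
  have ids: "bij_betw id ?U ?U" "bij_betw id V V" by simp_all
  note into2 = species2_into[OF H finite_atLeastAtMost V]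
  note comp2 = species2_comp[OF H finite_atLeastAtMost V]
  have orb: "scalar_orbit F H n V = (\<lambda>x. {act g x |g. g permutes ?U})"
    by (auto simp: scalar_orbit_def act_def fun_eq_iff)
  have "card {A \<in> (\<lambda>x. {act g x |g. g permutes ?U}) ` ?X. ?s ` A = A} * fact (card ?U) =
      (\<Sum>g | g permutes ?U. card {x \<in> ?X. ?s x = act g x})"
  proof (rule twisted_burnside)
    show "finite ?X" using species_finite[OF F] species2_finite[OF H _ V] by simp
    show "act g x \<in> ?X" if "g permutes ?U" "x \<in> ?X" for g x
      using that bij[OF that(1)] species_into[OF F] into2 ids by (auto simp: act_def)
    show "act id x = x" if "x \<in> ?X" for x
      using that species_id[OF F] species2_id[OF H _ V] by (auto simp: act_def)
    show "act (g \<circ> h) x = act g (act h x)" if "g permutes ?U" "h permutes ?U" "x \<in> ?X" for g h x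
      using that species_comp[OF F _ bij[OF that(2)] bij[OF that(1)]]
        comp2[OF bij[OF that(2)] bij[OF that(1)] ids(2,2)] by (auto simp: act_def)
    show "?s x \<in> ?X" if "x \<in> ?X" for x
      using that into2[OF ids(1) bij[OF \<tau>]] by auto
    have "inj_on (transport2 H ?U V id \<tau>) (structures2 H ?U V)"
    proof (rule inj_on_inverseI)
      fix h assume h: "h \<in> structures2 H ?U V"
      show "transport2 H ?U V id (inv \<tau>) (transport2 H ?U V id \<tau> h) = h"
        using comp2[OF ids(1,1) bij[OF \<tau>] bij[OF permutes_inv[OF \<tau>]] h]
          species2_id[OF H _ V h] permutes_inv_o(2)[OF \<tau>] by simp
    qed
    then show "inj_on ?s ?X" by (auto simp: inj_on_def)
    show "?s (act g x) = act g (?s x)" if "g permutes ?U" "x \<in> ?X" for g x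
      using that comp2[OF bij[OF that(1)] ids(1,2) bij[OF \<tau>]] comp2[OF ids(1) bij[OF that(1)] bij[OF \<tau>] ids(2)]
      by (auto simp: act_def)
  qed simp
  \<comment> \<open>Since \<tau> leaves t alone, the condition splits: \<sigma> fixes t, and
    \<sigma> and \<tau> move h alike.\<close>
  also have "\<dots> = (\<Sum>\<sigma>\<in>Sym n. card ({t \<in> structures F ?U. transport F ?U \<sigma> t = t} \<times>
      {h \<in> structures2 H ?U V. transport2 H ?U V id \<tau> h = transport2 H ?U V \<sigma> id h}))"
    by (intro sum.cong arg_cong[of _ _ card]) (auto simp: act_def)
  finally show ?thesis by (simp add: orb card_cartesian_product)
qed

section \<open>Cycle index of the inner plethysm\<close>

text \<open>The summand at \<sigma> depends only on its cycle type \<nu>. Grouping by type and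
  dividing by n! leaves the weight 1 / \<open>z_part \<nu>\<close>.\<close>

lemma card_fixed_inner_plethysm_degree:
  assumes F: "is_species F" and G: "is_species G" and V: "finite V" and \<tau>: "\<tau> permutes V"
  shows "of_nat (card {A \<in> scalar_orbit F (Phi G) n V ` (structures F {1..n} \<times> structures2 (Phi G) {1..n} V).
      (\<lambda>(t, h). (t, transport2 (Phi G) {1..n} V id \<tau> h)) ` A = A}) =
    (\<Sum>\<nu>\<in>partitions_of n. of_nat (fix_species F \<nu>) / of_nat (z_part \<nu>) *
      (\<Prod>k\<in>#\<nu>. of_nat (card {y \<in> structures G V. transport G V (\<tau> ^^ k) y = y})) :: complex)"
    (is "of_nat (card ?A) = (\<Sum>\<nu>\<in>_. _ * ?c \<nu>)")
proof -
  let ?d = "\<lambda>\<nu>. \<Prod>k\<in>#\<nu>. card {y \<in> structures G V. transport G V (\<tau> ^^ k) y = y}"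
  have Sym: "finite (Sym n)" by (rule finite_permutations) simp
  have "card ?A * fact n = (\<Sum>\<sigma>\<in>Sym n. fix_species F (cycle_type n \<sigma>) * ?d (cycle_type n \<sigma>))"
    unfolding card_fixed_scalar_orbits[OF F is_species2_Phi[OF G] V \<tau>]
    by (intro sum.cong) (simp_all only: card_fixed_Phi[OF G V _ \<tau>] card_fixed_eq_fix_species[OF F] mem_Collect_eq)
  also have "\<dots> = (\<Sum>\<nu>\<in>partitions_of n. \<Sum>\<sigma>\<in>{\<sigma> \<in> Sym n. cycle_type n \<sigma> = \<nu>}.
      fix_species F (cycle_type n \<sigma>) * ?d (cycle_type n \<sigma>))"
    using Sym finite_partitions_of cycle_type_in_partitions_of by (intro sum.group[symmetric]) auto
  also have "\<dots> = (\<Sum>\<nu>\<in>partitions_of n. card {\<sigma> \<in> Sym n. cycle_type n \<sigma> = \<nu>} * (fix_species F \<nu> * ?d \<nu>))"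
    by (intro sum.cong) simp_all
  finally have "card ?A * fact n =
      (\<Sum>\<nu>\<in>partitions_of n. card {\<sigma> \<in> Sym n. cycle_type n \<sigma> = \<nu>} * (fix_species F \<nu> * ?d \<nu>))" .
  from arg_cong[OF this, of "of_nat :: nat \<Rightarrow> complex"]
  have "of_nat (card ?A) * fact n =
      (\<Sum>\<nu>\<in>partitions_of n. of_nat (card {\<sigma> \<in> Sym n. cycle_type n \<sigma> = \<nu>}) *
        (of_nat (fix_species F \<nu>) * of_nat (?d \<nu>)) :: complex)"
    by (simp only: of_nat_mult of_nat_sum of_nat_fact)
  also have "\<dots> = (\<Sum>\<nu>\<in>partitions_of n. of_nat (fix_species F \<nu>) / of_nat (z_part \<nu>) * ?c \<nu> * fact n)"
  proof (rule sum.cong[OF refl])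
    fix \<nu> assume \<nu>: "\<nu> \<in> partitions_of n"
    have "of_nat (?d \<nu>) = ?c \<nu>" by (induction \<nu>) simp_all
    moreover have "z_part \<nu> > 0" using \<nu> by (simp add: partitions_of_def z_part_partition_pos)
    moreover have "of_nat (card {\<sigma> \<in> Sym n. cycle_type n \<sigma> = \<nu>}) * of_nat (z_part \<nu>) = (fact n :: complex)"
      using arg_cong[OF card_cycle_type_eq[OF \<nu>], of "of_nat :: nat \<Rightarrow> complex"]
      by (simp only: of_nat_mult of_nat_fact)
    ultimately show "of_nat (card {\<sigma> \<in> Sym n. cycle_type n \<sigma> = \<nu>}) *
        (of_nat (fix_species F \<nu>) * of_nat (?d \<nu>)) =
        of_nat (fix_species F \<nu>) / of_nat (z_part \<nu>) * ?c \<nu> * (fact n :: complex)"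
      by (simp add: field_simps)
  qed
  finally show ?thesis unfolding sum_distrib_right[symmetric] by simp
qed

lemma fix_species_eq_0:
  assumes "structures F {1..sum_mset \<nu>} = {}"
  shows "fix_species F \<nu> = 0"
  using assms by (simp add: fix_species_def Let_def)

theorem theorem2p12:
  fixes F :: "'s species" and G :: "'t species"
  assumes "is_species F" and "is_species G" and "strictly_finite F"
  shows "cycle_index (F \<boxtimes> G) = cycle_index F \<boxtimes>\<^sub>\<Lambda> cycle_index G"
proof (rule mfps_eqI)
  fix m :: "nat multiset"
  note F = assms(1) and G = assms(2)
  let ?n = "size m"
  let ?V = "{1..?n}"
  obtain N where N: "\<And>n. n > N \<Longrightarrow> structures F {1..n} = {}"
    using assms(3) unfolding strictly_finite_def by blast
  \<comment> \<open>Strict finiteness leaves only partitions of numbers up to N, which turns the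
    cycle index of F into a polynomial in the power sums.\<close>
  define P where "P = (\<Union>n\<le>N. partitions_of n)"
  have P: "finite P" "P \<subseteq> partitions"
    unfolding P_def by (intro finite_UN_I finite_partitions_of) (auto simp: partitions_of_def)
  let ?c = "\<lambda>\<nu>. of_nat (fix_species F \<nu>) / of_nat (z_part \<nu>) :: complex"
  have ZF: "cycle_index F = (\<Sum>\<nu>\<in>P. smult_mfps (?c \<nu>) (p_part \<nu>))"
  proof (rule mfps_eqI)
    fix m :: "nat multiset"
    have "?c \<nu> = 0" if "\<nu> \<in> partitions_of (size m) - P" for \<nu>
    proof -
      have "sum_mset \<nu> > N" using that by (auto simp: P_def partitions_of_def)
      then show ?thesis using fix_species_eq_0[of F \<nu>] N by simp
    qed
    then show "mcoeff (cycle_index F) m = mcoeff (\<Sum>\<nu>\<in>P. smult_mfps (?c \<nu>) (p_part \<nu>)) m"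
      unfolding mcoeff_cycle_index by (intro mcoeff_sum_partitions_of[symmetric] P)
  qed
  \<comment> \<open>The fixed point character of G in degree \<open>?n\<close>.\<close>
  define \<chi> where "\<chi> = (\<lambda>\<sigma>\<in>Sym ?n. of_nat (card {y \<in> structures G ?V. transport G ?V \<sigma> y = y}) :: complex)"
  have \<chi>: "\<chi> \<in> class_functions ?n"
  proof -
    have "card {y \<in> structures G ?V. transport G ?V (\<tau> \<circ> \<sigma> \<circ> inv \<tau>) y = y} =
        card {y \<in> structures G ?V. transport G ?V \<sigma> y = y}"
      if \<sigma>: "\<sigma> permutes ?V" and \<tau>: "\<tau> permutes ?V" for \<sigma> \<tau>
    proof (rule card_fixed_conj[OF G _ \<sigma> _ \<tau>, symmetric])
      show "\<tau> \<circ> \<sigma> \<circ> inv \<tau> permutes ?V" using \<sigma> \<tau> by (intro permutes_compose permutes_inv)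
      show "\<tau> \<circ> \<sigma> = \<tau> \<circ> \<sigma> \<circ> inv \<tau> \<circ> \<tau>" using permutes_inv_o(2)[OF \<tau>] by (simp add: comp_assoc)
    qed simp
    moreover have "\<tau> \<circ> \<sigma> \<circ> inv \<tau> permutes ?V" if "\<sigma> permutes ?V" "\<tau> permutes ?V" for \<sigma> \<tau>
      using that by (intro permutes_compose permutes_inv)
    ultimately show ?thesis by (simp add: class_functions_def \<chi>_def)
  qed
  have ZG: "homogeneous_part ?n (cycle_index G) = sf_of_class ?n \<chi>"
  proof (rule homogeneous_part_cycle_index)
    fix \<mu> assume "\<mu> \<in> partitions_of ?n"
    then have "sum_mset \<mu> = ?n" "perm_of_type \<mu> permutes ?V"
      using perm_of_type(1)[of \<mu>] by (auto simp: partitions_of_def)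
    then show "\<chi> (perm_of_type \<mu>) = of_nat (fix_species G \<mu>)"
      by (simp add: \<chi>_def fix_species_eq)
  qed
  have apply_type: "sf_apply ?n (cycle_index F) \<chi> (perm_of_type \<mu>) = of_nat (fix_species (F \<boxtimes> G) \<mu>)"
    if \<mu>: "\<mu> \<in> partitions_of ?n" for \<mu>
  proof -
    define \<tau> where "\<tau> = perm_of_type \<mu>"
    have sum: "sum_mset \<mu> = ?n" and \<tau>: "\<tau> permutes ?V"
      using perm_of_type(1)[of \<mu>] \<mu> by (auto simp: partitions_of_def \<tau>_def)
    let ?A = "\<lambda>n. {A \<in> scalar_orbit F (Phi G) n ?V ` (structures F {1..n} \<times> structures2 (Phi G) {1..n} ?V).
      (\<lambda>(t, h). (t, transport2 (Phi G) {1..n} ?V id \<tau> h)) ` A = A}"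
    \<comment> \<open>Transport preserves the tag n, so fixed structures are counted tag by tag;
      beyond N there are none.\<close>
    have "{x \<in> structures (F \<boxtimes> G) ?V. transport (F \<boxtimes> G) ?V \<tau> x = x} = (SIGMA n:{..N}. ?A n)"
      using N by (fastforce simp: inner_plethysm_species_def scalar_prod_def not_le[symmetric])
    moreover have "finite (?A n)" for n
      using species_finite[OF F] species2_finite[OF is_species2_Phi[OF G]] by simp
    ultimately have "of_nat (fix_species (F \<boxtimes> G) \<mu>) = (\<Sum>n\<le>N. of_nat (card (?A n)) :: complex)"
      unfolding fix_species_eq[OF sum] \<tau>_def[symmetric] by (simp add: card_SigmaI)
    also have "\<dots> = (\<Sum>n\<le>N. \<Sum>\<nu>\<in>partitions_of n. ?c \<nu> *
        (\<Prod>k\<in>#\<nu>. of_nat (card {y \<in> structures G ?V. transport G ?V (\<tau> ^^ k) y = y})))"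
      using \<tau> by (intro sum.cong card_fixed_inner_plethysm_degree F G) auto
    \<comment> \<open>The powers of \<tau> stay in the symmetric group, so neither \<chi> nor
      \<open>adams\<close> is evaluated at its default value.\<close>
    also have "\<dots> = (\<Sum>n\<le>N. \<Sum>\<nu>\<in>partitions_of n. ?c \<nu> * (\<Prod>k\<in>#\<nu>. adams ?n k \<chi> \<tau>))"
      using \<tau> permutes_funpow[OF \<tau>] by (simp add: adams_def \<chi>_def)
    also have "\<dots> = (\<Sum>\<nu>\<in>P. ?c \<nu> * (\<Prod>k\<in>#\<nu>. adams ?n k \<chi> \<tau>))"
      unfolding P_def
      by (intro sum.UNION_disjoint[symmetric] ballI finite_partitions_of) (auto simp: partitions_of_def)
    also have "\<dots> = sf_apply ?n (cycle_index F) \<chi> \<tau>"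
      unfolding ZF using P \<tau> by (intro sf_apply_sum[symmetric]) auto
    finally show ?thesis by (simp add: \<tau>_def)
  qed
  show "mcoeff (cycle_index (F \<boxtimes> G)) m = mcoeff (cycle_index F \<boxtimes>\<^sub>\<Lambda> cycle_index G) m"
    unfolding mcoeff_inner_plethysm_sf ZG class_of_sf_of_class[OF \<chi>]
    by (simp add: mcoeff_cycle_index mcoeff_sf_of_class apply_type)
qed
end
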